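(* Let $\mathbb{F}$ be a field of characteristic zero, let $d\ge n\ge 1$ be integers, and let $U$ be an $\mathbb{F}$-vector space of dimension $d+1$ with basis $\{e_1,\dots,e_d,e_\infty\}$. Let the extended Schur algebra $\mathcal{S}_{\mathbb{F}}(d,\mathbf{n})$ act on the left on $\otimes^n U$ by $$\xi e_\beta^{\otimes}=\sum_{\alpha\in\Gamma_X(d)}\xi(c_{\alpha,\beta})\,e_\alpha^{\otimes}\qquad(\xi\in\mathcal{S}_{\mathbb{F}}(d,\mathbf{n}),\ X\subseteq\mathbf{n},\ \beta\in\Gamma_X(d)).$$ For all $\sigma\in R_n$, $X\subseteq\mathbf{n}$ and $\alpha\in\Gamma_X(d)$ define $$e_\alpha^{\otimes}\cdot\sigma=\begin{cases}e_{\alpha\sigma}^{\otimes}&\text{if }X\subseteq R(\sigma),\\0&\text{otherwise,}\end{cases}$$ where $R(\sigma)$ is the range of $\sigma$ and $\alpha\sigma\in\Gamma_{\sigma^{-1}(X)}(d)$ is the composite partial map (first $\sigma$, then $\alpha$). Then this defines (by linear extension) a right $\mathbb{F}R_n$-module structure on $\otimes^n U$, and the left action of $\mathcal{S}_{\mathbb{F}}(d,\mathbf{n})$ and the right action of $\mathbb{F}R_n$ generate the full centralizers of each other in $\mathrm{End}_{\mathbb{F}}(\otimes^n U)$; that is, the image of $\mathcal{S}_{\mathbb{F}}(d,\mathbf{n})$ in $\mathrm{End}_{\mathbb{F}}(\otimes^n U)$ is $\mathrm{End}_{\mathbb{F}R_n}(\otimes^n U)$ and the image of $(\mathbb{F}R_n)^{\circ}$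 is $\mathrm{End}_{\mathcal{S}_{\mathbb{F}}(d,\mathbf{n})}(\otimes^n U)$. In addition, there are isomorphisms of $\mathbb{F}$-algebras $$\mathcal{S}_{\mathbb{F}}(d,\mathbf{n})\cong\mathrm{End}_{\mathbb{F}R_n}(\otimes^n U)\quad\text{and}\quad(\mathbb{F}R_n)^{\circ}\cong\mathrm{End}_{\mathcal{S}_{\mathbb{F}}(d,\mathbf{n})}(\otimes^n U).$$
   Context: Notation: $\mathbf{n}=\{1,\dots,n\}$, $\mathbf{d}=\{1,\dots,d\}$. $\mathcal{B}^{\circ}$ is the opposite algebra of $\mathcal{B}$. Rook monoid: $R_n$ is the monoid of all injective partial maps $\mathbf{n}\to\mathbf{n}$ (bijections between subsets of $\mathbf n$) under composition of partial maps, where $\sigma\tau$ means first $\tau$, then $\sigma$. It includes the empty map $\epsilon_\emptyset$, which is the zero element of the monoid. $\mathbb{F}R_n$ is the full monoid algebra with basis $R_n$ (in it, $\epsilon_\emptyset$ is a basis element, not identified with $0$). Monomials: $G_d=GL_d(\mathbb{F})$, and $c_{i,j}:G_d\to\mathbb{F}$ is the $(i,j)$-entry function ($1\le i,j\le d$). $\mathcal{A}(d)=\mathbb{F}[c_{i,j}]$ is the polynomial algebra in the $c_{i,j}$, and $\mathcal{A}(d,r)$ is its subspace of homogeneous polynomials of degree $r$. For $X\subseteq\mathbf{n}$, $\Gamma_X(d)$ is the set of all maps $X\to\mathbf{d}$ ($\Gamma_\emptyset(d)$ has one element, the empty map, also denoted $\emptyset$). For $\alpha,\beta\in\Gamma_X(d)$,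 $c_{\alpha,\beta}=\prod_{x\in X}c_{\alpha(x),\beta(x)}$ (equal to $1$ if $X=\emptyset$). Extended Schur algebra: $\mathcal{A}_{\mathbf{n}}(d)=\bigoplus_{r=0}^n\mathcal{A}(d,r)$ is spanned by all $c_{\alpha,\beta}$ with $\alpha,\beta\in\Gamma_X(d)$, $X\subseteq\mathbf{n}$. It is a coalgebra with $\Delta(c_{\alpha,\beta})=\sum_{\gamma\in\Gamma_X(d)}c_{\alpha,\gamma}\otimes c_{\gamma,\beta}$ and counit $\epsilon(c_{\alpha,\beta})=\delta_{\alpha,\beta}$. The extended Schur algebra is the dual algebra $\mathcal{S}_{\mathbb{F}}(d,\mathbf{n})=\mathrm{Hom}_{\mathbb{F}}(\mathcal{A}_{\mathbf{n}}(d),\mathbb{F})$, with product $(\xi\eta)(c_{\alpha,\beta})=\sum_{\gamma\in\Gamma_X(d)}\xi(c_{\alpha,\gamma})\eta(c_{\gamma,\beta})$ for $\alpha,\beta\in\Gamma_X(d)$ and unit $\epsilon$. Basis of $\otimes^n U$: for $X\subseteq\mathbf{n}$ and $\alpha\in\Gamma_X(d)$, $e_\alpha^{\otimes}=e_{\widehat\alpha(1)}\otimes\cdots\otimes e_{\widehat\alpha(n)}$, where $\widehat\alpha(i)=\alpha(i)$ if $i\in X$ and $\widehat\alpha(i)=\infty$ otherwise. The set $\{e_\alpha^{\otimes}:\alpha\in\Gamma_X(d),\ X\subseteq\mathbf{n}\}$ is a basis of $\otimes^n U$. *)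

theory Defs
  imports "Jordan_Normal_Form.Matrix" "HOL-Algebra.QuotRing"
begin

section \<open>Algebras over a field\<close>

text \<open>An F-algebra is presented as a record of the HOL-Algebra record type \<open>('a, 'b) module\<close>,
  which carries both the ring operations and the scalar multiplication.\<close>

definition alg_iso :: "('a, 'b, 'p) module_scheme \<Rightarrow> ('a, 'c, 'q) module_scheme \<Rightarrow> ('b \<Rightarrow> 'c) set" where
  "alg_iso A B = {h \<in> ring_iso A B. \<forall>k. \<forall>x\<in>carrier A. h (k \<odot>\<^bsub>A\<^esub> x) = k \<odot>\<^bsub>B\<^esub> h x}"

definition op_alg :: "('a, 'b) module \<Rightarrow> ('a, 'b) module" where
  "op_alg A = A\<lparr>mult := \<lambda>x y. y \<otimes>\<^bsub>A\<^esub> x\<rparr>"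

definition right_module_over ::
  "('a::field, 'b) module \<Rightarrow> ('a \<Rightarrow> 't::ab_group_add \<Rightarrow> 't) \<Rightarrow> ('b \<Rightarrow> 't \<Rightarrow> 't) \<Rightarrow> bool" where
  \<comment> \<open>\<open>act a t\<close> stands for the right multiple \<open>t \<cdot> a\<close>.\<close>
  "right_module_over A sT act \<longleftrightarrow>
     (\<forall>a\<in>carrier A. Vector_Spaces.linear sT sT (act a)) \<and>
     (\<forall>a\<in>carrier A. \<forall>b\<in>carrier A. \<forall>t. act (a \<oplus>\<^bsub>A\<^esub> b) t = act a t + act b t) \<and>
     (\<forall>k. \<forall>a\<in>carrier A. \<forall>t. act (k \<odot>\<^bsub>A\<^esub> a) t = sT k (act a t)) \<and>
     (\<forall>t. act \<one>\<^bsub>A\<^esub> t = t) \<and>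
     (\<forall>a\<in>carrier A. \<forall>b\<in>carrier A. \<forall>t. act (a \<otimes>\<^bsub>A\<^esub> b) t = act b (act a t))"

text \<open>The algebra of all linear endomorphisms commuting with every operator in \<open>K\<close>.\<close>

definition centralizer_alg ::
  "('a::field \<Rightarrow> 't::ab_group_add \<Rightarrow> 't) \<Rightarrow> ('t \<Rightarrow> 't) set \<Rightarrow> ('a, 't \<Rightarrow> 't) module" where
  "centralizer_alg sT K =
     \<lparr>carrier = {f. Vector_Spaces.linear sT sT f \<and> (\<forall>k\<in>K. f \<circ> k = k \<circ> f)},
      mult = (\<lambda>f g. f \<circ> g), one = id,
      zero = (\<lambda>t. 0), add = (\<lambda>f g t. f t + g t), smult = (\<lambda>k f t. sT k (f t))\<rparr>"


section \<open>The rook monoid and its monoid algebra\<close>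

text \<open>Partial maps are Isabelle maps; \<open>\<sigma> \<circ>\<^sub>m \<tau>\<close> is ``first \<open>\<tau>\<close>, then \<open>\<sigma>\<close>''.\<close>

definition rook :: "nat \<Rightarrow> (nat \<rightharpoonup> nat) set" where
  "rook n = {\<sigma>. dom \<sigma> \<subseteq> {1..n} \<and> ran \<sigma> \<subseteq> {1..n} \<and> inj_on \<sigma> (dom \<sigma>)}"

definition rook_one :: "nat \<Rightarrow> (nat \<rightharpoonup> nat)" where
  "rook_one n = (\<lambda>i. if i \<in> {1..n} then Some i else None)"

definition rook_alg :: "nat \<Rightarrow> ('a::field, (nat \<rightharpoonup> nat) \<Rightarrow> 'a) module" where
  "rook_alg n =
     \<lparr>carrier = {a. \<forall>\<sigma>. \<sigma> \<notin> rook n \<longrightarrow> a \<sigma> = 0},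
      mult = (\<lambda>a b \<rho>. \<Sum>(\<sigma>, \<tau>) \<in> {(\<sigma>, \<tau>). \<sigma> \<in> rook n \<and> \<tau> \<in> rook n \<and> \<sigma> \<circ>\<^sub>m \<tau> = \<rho>}. a \<sigma> * b \<tau>),
      one = (\<lambda>\<sigma>. if \<sigma> = rook_one n then 1 else 0),
      zero = (\<lambda>\<sigma>. 0), add = (\<lambda>a b \<sigma>. a \<sigma> + b \<sigma>), smult = (\<lambda>k a \<sigma>. k * a \<sigma>)\<rparr>"


section \<open>Polynomial functions on the general linear group\<close>

definition GL :: "nat \<Rightarrow> 'a::field mat set" where
  "GL d = {g \<in> carrier_mat d d. invertible_mat g}"

text \<open>A function on \<open>GL d\<close> is represented by its extension by zero to the whole matrix type.
  Matrix indices in the library start from 0, those of \<open>c_entry d\<close> from 1.\<close>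

definition on_GL :: "nat \<Rightarrow> ('a::field mat \<Rightarrow> 'a) \<Rightarrow> ('a mat \<Rightarrow> 'a)" where
  "on_GL d f = (\<lambda>g. if g \<in> GL d then f g else 0)"

definition c_entry :: "nat \<Rightarrow> nat \<Rightarrow> nat \<Rightarrow> 'a::field mat \<Rightarrow> 'a" where
  "c_entry d i j = on_GL d (\<lambda>g. g $$ (i - 1, j - 1))"

text \<open>Exponents of the monomials of degree \<open>r\<close> in the \<open>c_entry d i j\<close>, \<open>1 \<le> i, j \<le> d\<close>.\<close>

definition exponents :: "nat \<Rightarrow> nat \<Rightarrow> (nat \<times> nat \<Rightarrow> nat) set" where
  "exponents d r =
     {m. (\<forall>p. p \<notin> {1..d} \<times> {1..d} \<longrightarrow> m p = 0) \<and> (\<Sum>p\<in>{1..d} \<times> {1..d}. m p) = r}"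

definition poly_hom :: "nat \<Rightarrow> nat \<Rightarrow> ('a::field mat \<Rightarrow> 'a) set" where
  "poly_hom d r =
     {f. \<exists>a. f = on_GL d (\<lambda>g. \<Sum>m\<in>exponents d r.
                   a m * (\<Prod>(i, j)\<in>{1..d} \<times> {1..d}. c_entry d i j g ^ m (i, j)))}"

definition poly_upto :: "nat \<Rightarrow> nat \<Rightarrow> ('a::field mat \<Rightarrow> 'a) set" where
  "poly_upto d n = {f. \<exists>h. (\<forall>r\<le>n. h r \<in> poly_hom d r) \<and> f = (\<lambda>g. \<Sum>r\<le>n. h r g)}"

definition Gam :: "nat set \<Rightarrow> nat \<Rightarrow> (nat \<rightharpoonup> nat) set" where
  "Gam X d = {\<alpha>. dom \<alpha> = X \<and> ran \<alpha> \<subseteq> {1..d}}"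

text \<open>The monomial \<open>c\<^bsub>\<alpha>,\<beta>\<^esub>\<close>, meant for \<open>\<alpha>\<close> and \<open>\<beta>\<close> with the same domain.\<close>

definition cc :: "nat \<Rightarrow> (nat \<rightharpoonup> nat) \<Rightarrow> (nat \<rightharpoonup> nat) \<Rightarrow> 'a::field mat \<Rightarrow> 'a" where
  "cc d \<alpha> \<beta> = on_GL d (\<lambda>g. \<Prod>x\<in>dom \<alpha>. c_entry d (the (\<alpha> x)) (the (\<beta> x)) g)"


section \<open>The extended Schur algebra\<close>

text \<open>Linear forms on \<open>poly_upto d n\<close>; they are set to 0 outside this space, so that a linear form
  is a unique HOL function.\<close>

definition forms :: "nat \<Rightarrow> nat \<Rightarrow> (('a::field mat \<Rightarrow> 'a) \<Rightarrow> 'a) set" where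
  "forms d n =
     {\<xi>. (\<forall>f\<in>poly_upto d n. \<forall>h\<in>poly_upto d n. \<xi> (\<lambda>g. f g + h g) = \<xi> f + \<xi> h) \<and>
         (\<forall>k. \<forall>f\<in>poly_upto d n. \<xi> (\<lambda>g. k * f g) = k * \<xi> f) \<and>
         (\<forall>f. f \<notin> poly_upto d n \<longrightarrow> \<xi> f = 0)}"

text \<open>Product and unit are given by their values on the spanning set of all \<open>c\<^bsub>\<alpha>,\<beta>\<^esub>\<close>. Over an
  infinite field such forms exist, because two of these functions coincide only when a bijection of
  the domains carries one pair of indices to the other, and distinct ones are linearly
  independent.\<close>

definition schur_mult ::
  "nat \<Rightarrow> nat \<Rightarrow> (('a::field mat \<Rightarrow> 'a) \<Rightarrow> 'a) \<Rightarrow> (('a mat \<Rightarrow> 'a) \<Rightarrow> 'a) \<Rightarrow> (('a mat \<Rightarrow> 'a) \<Rightarrow> 'a)" where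
  "schur_mult d n \<xi> \<eta> =
     (THE \<zeta>. \<zeta> \<in> forms d n \<and>
        (\<forall>X\<subseteq>{1..n}. \<forall>\<alpha>\<in>Gam X d. \<forall>\<beta>\<in>Gam X d.
           \<zeta> (cc d \<alpha> \<beta>) = (\<Sum>\<gamma>\<in>Gam X d. \<xi> (cc d \<alpha> \<gamma>) * \<eta> (cc d \<gamma> \<beta>))))"

definition schur_one :: "nat \<Rightarrow> nat \<Rightarrow> (('a::field mat \<Rightarrow> 'a) \<Rightarrow> 'a)" where
  "schur_one d n =
     (THE \<zeta>. \<zeta> \<in> forms d n \<and>
        (\<forall>X\<subseteq>{1..n}. \<forall>\<alpha>\<in>Gam X d. \<forall>\<beta>\<in>Gam X d. \<zeta> (cc d \<alpha> \<beta>) = (if \<alpha> = \<beta> then 1 else 0)))"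

definition schur_alg :: "nat \<Rightarrow> nat \<Rightarrow> ('a::field, ('a mat \<Rightarrow> 'a) \<Rightarrow> 'a) module" where
  "schur_alg d n =
     \<lparr>carrier = forms d n, mult = schur_mult d n, one = schur_one d n,
      zero = (\<lambda>f. 0), add = (\<lambda>\<xi> \<eta> f. \<xi> f + \<eta> f), smult = (\<lambda>k \<xi> f. k * \<xi> f)\<rparr>"


section \<open>Bases and tensor powers\<close>

definition basis_family :: "('a::field \<Rightarrow> 'v::ab_group_add \<Rightarrow> 'v) \<Rightarrow> 'i set \<Rightarrow> ('i \<Rightarrow> 'v) \<Rightarrow> bool" where
  "basis_family s I b \<longleftrightarrow>
     vector_space s \<and> inj_on b I \<and> \<not> Modules.module.dependent s (b ` I) \<and>
     Modules.module.span s (b ` I) = UNIV"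

definition lin_ext ::
  "('a::field \<Rightarrow> 'v::ab_group_add \<Rightarrow> 'v) \<Rightarrow> 'i set \<Rightarrow> ('i \<Rightarrow> 'v) \<Rightarrow> ('i \<Rightarrow> 'v) \<Rightarrow> 'v \<Rightarrow> 'v" where
  \<comment> \<open>the linear map with \<open>b i \<mapsto> w i\<close>, meant for a basis \<open>b\<close> indexed by \<open>I\<close>\<close>
  "lin_ext s I b w = (THE f. Vector_Spaces.linear s s f \<and> (\<forall>i\<in>I. f (b i) = w i))"

text \<open>Tuples \<open>(u\<^sub>1, \<dots>, u\<^sub>n)\<close> are functions on \<open>nat\<close> whose values outside \<open>{1..n}\<close> are irrelevant.\<close>

definition multilinear ::
  "('a::field \<Rightarrow> 'u::ab_group_add \<Rightarrow> 'u) \<Rightarrow> ('a \<Rightarrow> 'w::ab_group_add \<Rightarrow> 'w) \<Rightarrow> nat \<Rightarrow>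
     ((nat \<Rightarrow> 'u) \<Rightarrow> 'w) \<Rightarrow> bool" where
  "multilinear sU sW n \<phi> \<longleftrightarrow>
     (\<forall>u v. (\<forall>i\<in>{1..n}. u i = v i) \<longrightarrow> \<phi> u = \<phi> v) \<and>
     (\<forall>i\<in>{1..n}. \<forall>u. Vector_Spaces.linear sU sW (\<lambda>x. \<phi> (u(i := x))))"

text \<open>The universal property of \<open>(u\<^sub>1, \<dots>, u\<^sub>n) \<mapsto> u\<^sub>1 \<otimes> \<dots> \<otimes> u\<^sub>n\<close>. Since HOL cannot quantify over
  target spaces of arbitrary type, it is required for scalar-valued multilinear maps. This determines
  the tensor power: the comparison map from any tensor power has a bijective transpose, so it is
  itself bijective.\<close>

definition is_tensor_power ::
  "('a::field \<Rightarrow> 'u::ab_group_add \<Rightarrow> 'u) \<Rightarrow> ('a \<Rightarrow> 't::ab_group_add \<Rightarrow> 't) \<Rightarrow> nat \<Rightarrow>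
     ((nat \<Rightarrow> 'u) \<Rightarrow> 't) \<Rightarrow> bool" where
  "is_tensor_power sU sT n tens \<longleftrightarrow>
     vector_space sT \<and> multilinear sU sT n tens \<and>
     (\<forall>\<phi> :: (nat \<Rightarrow> 'u) \<Rightarrow> 'a. multilinear sU (*) n \<phi> \<longrightarrow>
        (\<exists>!L. Vector_Spaces.linear sT (*) L \<and> (\<forall>u. L (tens u) = \<phi> u)))"


section \<open>The two actions on the tensor power\<close>

text \<open>The basis of \<open>U\<close> is indexed by \<open>Some 1, \<dots>, Some d\<close> and \<open>None\<close>, the latter playing the role
  of \<open>\<infinity>\<close>. Hence a partial map \<open>\<alpha>\<close>, read as a function into \<open>nat option\<close>, is already its own
  extension by \<open>\<infinity>\<close>.\<close>

definition U_index :: "nat \<Rightarrow> nat option set" where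
  "U_index d = insert None (Some ` {1..d})"

definition e_tens :: "((nat \<Rightarrow> 'u) \<Rightarrow> 't) \<Rightarrow> (nat option \<Rightarrow> 'u) \<Rightarrow> (nat \<rightharpoonup> nat) \<Rightarrow> 't" where
  "e_tens tens e \<alpha> = tens (\<lambda>i. e (\<alpha> i))"

definition T_index :: "nat \<Rightarrow> nat \<Rightarrow> (nat \<rightharpoonup> nat) set" where
  "T_index d n = (\<Union>X\<in>Pow {1..n}. Gam X d)"

text \<open>In both actions \<open>E\<close> is the basis \<open>\<alpha> \<mapsto> e\<^bsub>\<alpha>\<^esub>\<close> of the tensor power.\<close>

definition schur_act ::
  "('a::field \<Rightarrow> 't::ab_group_add \<Rightarrow> 't) \<Rightarrow> nat \<Rightarrow> nat \<Rightarrow> ((nat \<rightharpoonup> nat) \<Rightarrow> 't) \<Rightarrow>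
     (('a mat \<Rightarrow> 'a) \<Rightarrow> 'a) \<Rightarrow> 't \<Rightarrow> 't" where
  "schur_act sT d n E \<xi> =
     lin_ext sT (T_index d n) E (\<lambda>\<beta>. \<Sum>\<alpha>\<in>Gam (dom \<beta>) d. sT (\<xi> (cc d \<alpha> \<beta>)) (E \<alpha>))"

definition rook_act1 ::
  "('a::field \<Rightarrow> 't::ab_group_add \<Rightarrow> 't) \<Rightarrow> nat \<Rightarrow> nat \<Rightarrow> ((nat \<rightharpoonup> nat) \<Rightarrow> 't) \<Rightarrow>
     (nat \<rightharpoonup> nat) \<Rightarrow> 't \<Rightarrow> 't" where
  "rook_act1 sT d n E \<sigma> =
     lin_ext sT (T_index d n) E (\<lambda>\<alpha>. if dom \<alpha> \<subseteq> ran \<sigma> then E (\<alpha> \<circ>\<^sub>m \<sigma>) else 0)"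

definition rook_act ::
  "('a::field \<Rightarrow> 't::ab_group_add \<Rightarrow> 't) \<Rightarrow> nat \<Rightarrow> nat \<Rightarrow> ((nat \<rightharpoonup> nat) \<Rightarrow> 't) \<Rightarrow>
     ((nat \<rightharpoonup> nat) \<Rightarrow> 'a) \<Rightarrow> 't \<Rightarrow> 't" where
  "rook_act sT d n E a t = (\<Sum>\<sigma>\<in>rook n. sT (a \<sigma>) (rook_act1 sT d n E \<sigma> t))"

end

theory Submission
  imports Defs "Jordan_Normal_Form.Char_Poly" "HOL-Library.Multiset"
begin

text \<open>In the basis of all \<open>e\<^bsub>\<alpha>\<^esub>\<close>, a form \<open>\<xi>\<close> acts by a matrix that is block diagonal with respect to the
  domains of the indices and constant on the classes of pairs \<open>(\<alpha>, \<beta>) \<sim> (\<alpha>\<pi>, \<beta>\<pi>)\<close> for bijections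
  \<open>\<pi>\<close> onto the common domain. Since distinct monomials are linearly independent on \<open>GL d\<close>, every such
  matrix arises, and these matrices are exactly those that commute with all rook elements.

  Conversely, let \<open>f\<close> commute with all forms. If \<open>\<iota>\<close> is the identity of \<open>X = dom \<beta>\<close>, which is an index
  because \<open>n \<le> d\<close>, then the form that is 1 on the class of \<open>(\<beta>, \<iota>)\<close> and 0 on all others sends
  \<open>e\<^bsub>\<gamma>\<^esub>\<close> to \<open>e\<^bsub>\<beta>\<gamma>\<^esub>\<close> if \<open>\<gamma>\<close> is a rook element with range \<open>X\<close> and to 0 otherwise; in particular it sends
  \<open>e\<^bsub>\<iota>\<^esub>\<close> to \<open>e\<^bsub>\<beta>\<^esub>\<close>. Hence \<open>f\<close> is the combination, with coefficients read off from the
  vectors \<open>f e\<^bsub>\<iota>\<^esub>\<close>, of the operators \<open>e\<^bsub>\<alpha>\<^esub> \<mapsto> e\<^bsub>\<alpha>\<gamma>\<^esub>\<close> (if \<open>dom \<alpha> = ran \<gamma>\<close>, else 0). These span the image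
  of the rook algebra: the action of \<open>\<sigma>\<close> is the sum of these operators over all restrictions
  of \<open>\<sigma>\<close>, a triangular relation.\<close>

section \<open>Bases of tensor powers\<close>

locale finite_basis = vector_space s
  for s :: "'a::field \<Rightarrow> 'v::ab_group_add \<Rightarrow> 'v" +
  fixes I :: "'i set" and b :: "'i \<Rightarrow> 'v"
  assumes finite_I: "finite I"
    and inj_b: "inj_on b I"
    and independent_b: "independent (b ` I)"
    and span_b: "span (b ` I) = UNIV"
begin

text \<open>The library takes coordinates over a set of basis vectors; injectivity of
  \<open>b\<close> lets them be indexed by \<open>I\<close> instead.\<close>

definition coord :: "'v \<Rightarrow> 'i \<Rightarrow> 'a" where
  "coord t i = representation (b ` I) t (b i)"

lemma sum_coord: "(\<Sum>i\<in>I. s (coord t i) (b i)) = t"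
proof -
  have "(\<Sum>v\<in>b ` I. s (representation (b ` I) t v) v) = t"
    using sum_representation_eq[OF independent_b, of t "b ` I"] span_b finite_I by auto
  then show ?thesis
    by (simp add: sum.reindex[OF inj_b] coord_def)
qed

lemma linear_coord: "Vector_Spaces.linear s (*) (\<lambda>t. coord t i)"
  unfolding coord_def by (rule linear_representation[OF independent_b span_b])

lemma coord_add: "coord (x + y) i = coord x i + coord y i"
  using linear_coord[of i] by (simp add: Vector_Spaces.linear_iff)

lemma coord_scale: "coord (s k x) i = k * coord x i"
  using linear_coord[of i] by (simp add: Vector_Spaces.linear_iff)

lemma coord_sum: "coord (sum f A) i = (\<Sum>j\<in>A. coord (f j) i)"
  using module_hom.sum[of s "(*)" "\<lambda>t. coord t i"] linear_coord[of i]
  by (simp add: Vector_Spaces.linear_iff_module_hom)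

lemma coord_basis:
  assumes "i \<in> I" "j \<in> I"
  shows "coord (b j) i = (if i = j then 1 else 0)"
  using assms inj_b unfolding coord_def
  by (subst representation_basis[OF independent_b]) (auto simp: inj_on_def)

lemma coord_comb:
  assumes "i \<in> I" "J \<subseteq> I"
  shows "coord (\<Sum>j\<in>J. s (c j) (b j)) i = (if i \<in> J then c i else 0)"
proof -
  have "finite J" using assms finite_I finite_subset by blast
  have "coord (\<Sum>j\<in>J. s (c j) (b j)) i = (\<Sum>j\<in>J. if i = j then c j else 0)"
    unfolding coord_sum coord_scale
    by (rule sum.cong) (use assms in \<open>auto simp: coord_basis\<close>)
  then show ?thesis
    using \<open>finite J\<close> by (simp add: sum.delta)
qed

lemma coord_eqI:
  assumes "\<And>i. i \<in> I \<Longrightarrow> coord x i = coord y i"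
  shows "x = y"
proof -
  have "(\<Sum>i\<in>I. s (coord x i) (b i)) = (\<Sum>i\<in>I. s (coord y i) (b i))"
    by (rule sum.cong) (simp_all add: assms)
  then show ?thesis by (simp only: sum_coord)
qed

lemma linear_expand:
  assumes "Vector_Spaces.linear s s' f"
  shows "f t = (\<Sum>i\<in>I. s' (coord t i) (f (b i)))"
proof -
  interpret hom: module_hom s s' f
    using assms by (simp add: Vector_Spaces.linear_iff_module_hom)
  have "f t = f (\<Sum>i\<in>I. s (coord t i) (b i))"
    by (simp add: sum_coord)
  also have "\<dots> = (\<Sum>i\<in>I. s' (coord t i) (f (b i)))"
    by (simp only: hom.sum hom.scale)
  finally show ?thesis .
qed

lemma linear_eqI:
  assumes "Vector_Spaces.linear s s' f" "Vector_Spaces.linear s s' g"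
    and "\<And>i. i \<in> I \<Longrightarrow> f (b i) = g (b i)"
  shows "f = g"
proof
  fix t
  have "(\<Sum>i\<in>I. s' (coord t i) (f (b i))) = (\<Sum>i\<in>I. s' (coord t i) (g (b i)))"
    by (rule sum.cong) (simp_all add: assms(3))
  then show "f t = g t"
    using linear_expand[OF assms(1), of t] linear_expand[OF assms(2), of t] by (simp only:)
qed

lemma linear_sum_coord: "Vector_Spaces.linear s s (\<lambda>t. \<Sum>i\<in>I. s (coord t i) (w i))"
  by (auto simp: Vector_Spaces.linear_iff coord_add coord_scale scale_left_distrib sum.distrib
      scale_sum_right vector_space_axioms)

text \<open>\<open>lin_ext\<close> is a definite description, so the explicit formula has to be
  linear, correct on the basis, and the only such map.\<close>

lemma lin_ext_eq: "lin_ext s I b w = (\<lambda>t. \<Sum>i\<in>I. s (coord t i) (w i))"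
  unfolding lin_ext_def
proof (rule the_equality)
  have "(\<Sum>j\<in>I. s (coord (b i) j) (w j)) = w i" if "i \<in> I" for i
  proof -
    have "(\<Sum>j\<in>I. s (coord (b i) j) (w j)) = (\<Sum>j\<in>I. if j = i then w j else 0)"
      by (rule sum.cong) (use that in \<open>auto simp: coord_basis\<close>)
    then show ?thesis using that finite_I by simp
  qed
  then show *: "Vector_Spaces.linear s s (\<lambda>t. \<Sum>i\<in>I. s (coord t i) (w i)) \<and>
      (\<forall>i\<in>I. (\<Sum>j\<in>I. s (coord (b i) j) (w j)) = w i)"
    using linear_sum_coord by blast
  show "f = (\<lambda>t. \<Sum>i\<in>I. s (coord t i) (w i))"
    if "Vector_Spaces.linear s s f \<and> (\<forall>i\<in>I. f (b i) = w i)" for f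
    by (rule linear_eqI[of s]) (use that * in auto)
qed

lemma linear_lin_ext: "Vector_Spaces.linear s s (lin_ext s I b w)"
  unfolding lin_ext_eq by (rule linear_sum_coord)

lemma lin_ext_basis:
  assumes "i \<in> I"
  shows "lin_ext s I b w (b i) = w i"
proof -
  have "(\<Sum>j\<in>I. s (coord (b i) j) (w j)) = (\<Sum>j\<in>I. if j = i then w j else 0)"
    by (rule sum.cong) (use assms in \<open>auto simp: coord_basis\<close>)
  then show ?thesis using assms finite_I by (simp add: lin_ext_eq)
qed

end

section \<open>Index sets, multilinear maps, and the basis of the tensor power\<close>

lemma finite_Gam:
  assumes "finite X"
  shows "finite (Gam X d)"
proof (rule finite_subset)
  show "Gam X d \<subseteq> {\<alpha>. dom \<alpha> = X \<and> ran \<alpha> \<subseteq> {1..d}}"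
    by (auto simp: Gam_def)
  show "finite {\<alpha>. dom \<alpha> = X \<and> ran \<alpha> \<subseteq> {1..d}}"
    by (rule finite_set_of_finite_maps) (use assms in auto)
qed

lemma T_index_iff: "\<alpha> \<in> T_index d n \<longleftrightarrow> dom \<alpha> \<subseteq> {1..n} \<and> ran \<alpha> \<subseteq> {1..d}"
  by (auto simp: T_index_def Gam_def)

lemma finite_T_index: "finite (T_index d n)"
  unfolding T_index_def by (auto intro!: finite_Gam intro: finite_subset)

lemma finite_basis_of_basis_family:
  assumes "basis_family s I b" "finite I"
  shows "finite_basis s I b"
proof -
  interpret vector_space s using assms(1) by (simp add: basis_family_def)
  show ?thesis
    using assms by unfold_locales (auto simp only: basis_family_def)
qed

text \<open>The arguments are expanded in the basis one slot at a time: the induction on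
  \<open>k\<close> lets the slots up to \<open>k\<close> be arbitrary, while the later ones already
  hold basis vectors.\<close>

lemma multilinear_eq_0:
  fixes \<phi> :: "(nat \<Rightarrow> 'u::ab_group_add) \<Rightarrow> 'w::ab_group_add"
  assumes "multilinear sU sW n \<phi>"
    and "finite_basis sU I e"
    and basis: "\<And>u. (\<forall>i\<in>{1..n}. u i \<in> e ` I) \<Longrightarrow> \<phi> u = 0"
  shows "\<phi> u = 0"
proof -
  interpret finite_basis sU I e by fact
  have "\<phi> u = 0" if "k \<le> n" "\<forall>i\<in>{1..n}. k < i \<longrightarrow> u i \<in> e ` I" for k u
    using that
  proof (induction k arbitrary: u)
    case 0
    then show ?case by (intro basis) auto
  next
    case (Suc k)
    have lin: "Vector_Spaces.linear sU sW (\<lambda>x. \<phi> (u(Suc k := x)))"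
      using assms(1) Suc.prems by (auto simp: multilinear_def)
    then interpret W: vector_space sW by (simp add: Vector_Spaces.linear_iff)
    have "\<phi> (u(Suc k := e i)) = 0" if "i \<in> I" for i
      by (rule Suc.IH) (use Suc.prems that in \<open>auto simp: less_Suc_eq\<close>)
    \<comment> \<open>The tuple is written as an update of itself so that linearity in slot
      \<open>Suc k\<close> applies.\<close>
    then have "\<phi> (u(Suc k := u (Suc k))) = 0"
      using linear_expand[OF lin, of "u (Suc k)"] by (simp del: fun_upd_triv)
    then show ?case by simp
  qed
  from this[of n] show ?thesis by auto
qed

lemma multilinear_prod_coord:
  fixes sU :: "'a::field \<Rightarrow> 'u::ab_group_add \<Rightarrow> 'u"
  assumes "finite_basis sU I e"
  shows "multilinear sU (*) n (\<lambda>u. \<Prod>i\<in>{1..n}. finite_basis.coord sU I e (u i) (\<alpha> i))"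
proof -
  interpret finite_basis sU I e by fact
  \<comment> \<open>Only the factor at \<open>i\<close> depends on \<open>x\<close>; splitting it
    off exhibits the linearity in slot \<open>i\<close>.\<close>
  have *: "(\<Prod>j\<in>{1..n}. coord ((u(i := x)) j) (\<alpha> j)) =
      coord x (\<alpha> i) * (\<Prod>j\<in>{1..n} - {i}. coord (u j) (\<alpha> j))" if "i \<in> {1..n}" for u i x
    by (subst prod.remove[OF _ that]) (auto intro!: arg_cong2[of _ _ _ _ "(*)"] prod.cong)
  show ?thesis
    unfolding multilinear_def
  proof (intro conjI allI impI ballI, goal_cases)
    case (1 u v)
    then show ?case by (intro prod.cong) auto
  next
    case (2 i u)
    have "vector_space ((*) :: 'a \<Rightarrow> 'a \<Rightarrow> 'a)"
      by unfold_locales (auto simp: algebra_simps)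
    then show ?case
      unfolding *[OF 2] Vector_Spaces.linear_iff using vector_space_axioms
      by (auto simp: coord_add coord_scale algebra_simps)
  qed
qed

lemma multilinear_comp_linear:
  assumes "multilinear sU sT n \<phi>" "Vector_Spaces.linear sT sW L"
  shows "multilinear sU sW n (\<lambda>u. L (\<phi> u))"
  unfolding multilinear_def
proof (intro conjI allI impI ballI)
  show "L (\<phi> u) = L (\<phi> v)" if "\<forall>i\<in>{1..n}. u i = v i" for u v
    using assms(1) that unfolding multilinear_def by metis
  show "Vector_Spaces.linear sU sW (\<lambda>x. L (\<phi> (u(i := x))))" if "i \<in> {1..n}" for i u
    using Vector_Spaces.linear_compose[of sU sT "\<lambda>x. \<phi> (u(i := x))" sW L] assms that
    by (auto simp: multilinear_def o_def)
qed

text \<open>A linear form that kills all \<open>e\<^bsub>\<alpha>\<^esub>\<close> kills all pure tensors, so it is 0 by the uniqueness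
  part of the universal property; and the products of coordinate functions give dual vectors.\<close>

lemma tensor_power_basis:
  fixes sU :: "'a::field \<Rightarrow> 'u::ab_group_add \<Rightarrow> 'u" and sT :: "'a \<Rightarrow> 't::ab_group_add \<Rightarrow> 't"
  assumes "basis_family sU (U_index d) e" "is_tensor_power sU sT n tens"
  shows "finite_basis sT (T_index d n) (e_tens tens e)"
proof -
  let ?E = "e_tens tens e" and ?I = "T_index d n"
  have U: "finite_basis sU (U_index d) e"
    by (rule finite_basis_of_basis_family[OF assms(1)]) (simp add: U_index_def)
  interpret U: finite_basis sU "U_index d" e by fact
  interpret T: vector_space sT using assms(2) by (simp add: is_tensor_power_def)
  interpret F: vector_space "(*) :: 'a \<Rightarrow> 'a \<Rightarrow> 'a"
    by unfold_locales (auto simp: algebra_simps)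
  interpret TF: vector_space_pair sT "(*) :: 'a \<Rightarrow> 'a \<Rightarrow> 'a" ..
  have mult: "multilinear sU sT n tens"
    using assms(2) by (simp add: is_tensor_power_def)
  have univ: "\<exists>!L. Vector_Spaces.linear sT (*) L \<and> (\<forall>u. L (tens u) = \<phi> u)"
    if "multilinear sU (*) n \<phi>" for \<phi> :: "(nat \<Rightarrow> 'u) \<Rightarrow> 'a"
    using assms(2) that by (simp add: is_tensor_power_def)
  have U_index: "\<alpha> i \<in> U_index d" if "\<alpha> \<in> ?I" for \<alpha> i
    using that by (cases "\<alpha> i") (auto simp: U_index_def T_index_iff ran_def)
  have dual: "\<exists>L. Vector_Spaces.linear sT (*) L \<and> (\<forall>\<beta>\<in>?I. L (?E \<beta>) = (if \<alpha> = \<beta> then 1 else 0))"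
    if \<alpha>: "\<alpha> \<in> ?I" for \<alpha>
  proof -
    obtain L where L: "Vector_Spaces.linear sT (*) L"
        "\<And>u. L (tens u) = (\<Prod>i\<in>{1..n}. U.coord (u i) (\<alpha> i))"
      using univ[OF multilinear_prod_coord[OF U, of n \<alpha>]] by blast
    have "L (?E \<beta>) = (if \<alpha> = \<beta> then 1 else 0)" if \<beta>: "\<beta> \<in> ?I" for \<beta>
    proof (cases "\<alpha> = \<beta>")
      case True
      then show ?thesis
        unfolding e_tens_def L(2) by (simp add: U.coord_basis U_index[OF \<beta>])
    next
      case False
      then obtain i where i: "\<alpha> i \<noteq> \<beta> i" by auto
      \<comment> \<open>Outside \<open>{1..n}\<close> both maps are undefined, so they differ at a
        genuine tensor slot, and the factor of the product at that slot is 0.\<close>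
      have "i \<in> {1..n}"
        using i \<alpha> \<beta> unfolding T_index_iff by (metis domIff subsetD)
      with i show ?thesis
        unfolding e_tens_def L(2)
        using False by (auto simp: U.coord_basis U_index[OF \<alpha>] U_index[OF \<beta>] intro!: prod_zero)
    qed
    with L(1) show ?thesis by blast
  qed
  have inj: "inj_on ?E ?I"
  proof (rule inj_onI)
    fix \<alpha> \<beta> assume *: "\<alpha> \<in> ?I" "\<beta> \<in> ?I" "?E \<alpha> = ?E \<beta>"
    with dual[OF *(1)] show "\<alpha> = \<beta>"
      by (metis zero_neq_one)
  qed
  have indep: "T.independent (?E ` ?I)"
  proof
    assume "T.dependent (?E ` ?I)"
    then obtain c v where c: "(\<Sum>v\<in>?E ` ?I. sT (c v) v) = 0" "v \<in> ?E ` ?I" "c v \<noteq> 0"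
      using T.dependent_finite[of "?E ` ?I"] finite_T_index by blast
    then obtain \<alpha> where \<alpha>: "\<alpha> \<in> ?I" "v = ?E \<alpha>" by blast
    obtain L where L: "Vector_Spaces.linear sT (*) L"
        "\<And>\<beta>. \<beta> \<in> ?I \<Longrightarrow> L (?E \<beta>) = (if \<alpha> = \<beta> then 1 else 0)"
      using dual[OF \<alpha>(1)] by blast
    have "0 = L (\<Sum>\<beta>\<in>?I. sT (c (?E \<beta>)) (?E \<beta>))"
      using c(1) TF.linear_0[OF L(1)] by (simp add: sum.reindex[OF inj])
    also have "\<dots> = (\<Sum>\<beta>\<in>?I. c (?E \<beta>) * L (?E \<beta>))"
      by (simp add: TF.linear_sum[OF L(1)] TF.linear_scale[OF L(1)])
    also have "\<dots> = (\<Sum>\<beta>\<in>?I. if \<alpha> = \<beta> then c (?E \<beta>) else 0)"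
      by (rule sum.cong) (auto simp: L(2))
    also have "\<dots> = c v"
      using \<alpha> finite_T_index by simp
    finally show False using c(3) by simp
  qed
  have "T.span (?E ` ?I) = UNIV"
  proof (rule ccontr)
    assume "T.span (?E ` ?I) \<noteq> UNIV"
    then obtain t where t: "t \<notin> T.span (?E ` ?I)" by blast
    \<comment> \<open>A vector \<open>t\<close> outside the span can be added to the independent
      family, which yields a form that is 1 at \<open>t\<close> and 0 on every basis tensor.\<close>
    then have indep': "T.independent (insert t (?E ` ?I))"
      using indep by (simp add: T.independent_insert)
    obtain L where L: "Vector_Spaces.linear sT (*) L"
        "\<forall>v\<in>insert t (?E ` ?I). L v = (if v = t then 1 else (0 :: 'a))"
      using TF.linear_independent_extend[OF indep', of "\<lambda>v. if v = t then 1 else 0"] by blast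
    have L0: "L v = 0" if "v \<in> ?E ` ?I" for v
      using L(2) that t T.span_base by force
    have "L (tens u) = 0" for u
    proof (rule multilinear_eq_0[OF multilinear_comp_linear[OF mult L(1)] U])
      fix u assume u: "\<forall>i\<in>{1..n}. u i \<in> e ` U_index d"
      define a where "a i = inv_into (U_index d) e (u i)" for i
      have a: "a i \<in> U_index d \<and> u i = e (a i)" if "i \<in> {1..n}" for i
        using u that by (simp add: a_def inv_into_into f_inv_into_f)
      \<comment> \<open>The tuple \<open>u\<close> is arbitrary outside \<open>{1..n}\<close>, where
        \<open>tens\<close> ignores it; the value \<open>None\<close> there makes
        \<open>\<alpha>\<close> an admissible index.\<close>
      define \<alpha> where "\<alpha> = (\<lambda>i. if i \<in> {1..n} then a i else None)"
      have "\<alpha> \<in> ?I"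
        unfolding T_index_iff
      proof
        show "dom \<alpha> \<subseteq> {1..n}" by (auto simp: \<alpha>_def split: if_splits)
        show "ran \<alpha> \<subseteq> {1..d}"
        proof
          fix j assume "j \<in> ran \<alpha>"
          then obtain i where "\<alpha> i = Some j" by (auto simp: ran_def)
          then have "Some j \<in> U_index d"
            using a[of i] by (auto simp: \<alpha>_def split: if_splits)
          then show "j \<in> {1..d}" by (auto simp: U_index_def)
        qed
      qed
      moreover have "tens u = ?E \<alpha>"
        using mult a unfolding multilinear_def e_tens_def \<alpha>_def by simp
      ultimately show "L (tens u) = 0" using L0 by simp
    qed
    moreover have "Vector_Spaces.linear sT (*) (\<lambda>_. 0 :: 'a)"
      by (simp add: TF.linear_zero)
    moreover have "multilinear sU (*) n (\<lambda>_. 0 :: 'a)"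
      using U.vector_space_axioms F.vector_space_axioms
      by (auto simp: multilinear_def Vector_Spaces.linear_iff)
    ultimately have "L = (\<lambda>_. 0)"
      using univ[of "\<lambda>_. 0"] L(1) by auto
    then show False using L(2) by simp
  qed
  with inj indep show ?thesis
    using finite_T_index by unfold_locales auto
qed

section \<open>Polynomial functions on the general linear group and their linear forms\<close>

text \<open>The lowest digit is the residue modulo \<open>B\<close>; removing it and dividing by
  \<open>B\<close> leaves an expansion with one digit fewer. The digits will be the exponents of a
  monomial.\<close>

lemma digits_unique:
  fixes B :: nat
  assumes "\<And>k. k < N \<Longrightarrow> e k < B" "\<And>k. k < N \<Longrightarrow> e' k < B"
    and "(\<Sum>k<N. e k * B ^ k) = (\<Sum>k<N. e' k * B ^ k)" "k < N"
  shows "e k = e' k"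
  using assms
proof (induction N arbitrary: e e' k)
  case (Suc N)
  let ?r = "\<lambda>e. \<Sum>k<N. e (Suc k) * B ^ k"
  have split: "(\<Sum>k<Suc N. e k * B ^ k) = e 0 + B * ?r e" for e :: "nat \<Rightarrow> nat"
    by (subst sum.lessThan_Suc_shift) (simp add: sum_distrib_left mult_ac)
  have *: "e 0 + B * ?r e = e' 0 + B * ?r e'"
    using Suc.prems(3) by (simp only: split)
  have less: "e 0 < B" "e' 0 < B" using Suc.prems by auto
  have 0: "e 0 = e' 0"
    using arg_cong[OF *, of "\<lambda>x. x mod B"] less by simp
  with * less have "?r e = ?r e'" by auto
  then have "e (Suc k) = e' (Suc k)" if "k < N" for k
    using that Suc.prems(1,2)
    by (intro Suc.IH[of "\<lambda>k. e (Suc k)" "\<lambda>k. e' (Suc k)"]) auto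
  with 0 Suc.prems(4) show ?case by (cases k) auto
qed simp

text \<open>Kronecker substitution \<open>x\<^sub>p = t ^ B ^ k\<close>, with \<open>k\<close> the number of the variable \<open>p\<close> and \<open>B\<close>
  larger than all exponents, turns distinct monomials into distinct powers of \<open>t\<close>.\<close>

lemma monomials_independent:
  fixes a :: "('j \<Rightarrow> nat) \<Rightarrow> 'a::field_char_0"
  assumes "finite J" "finite M"
    and supp: "\<And>m p. m \<in> M \<Longrightarrow> p \<notin> J \<Longrightarrow> m p = 0"
    and zero: "\<And>x. (\<Sum>m\<in>M. a m * (\<Prod>p\<in>J. x p ^ m p)) = 0"
    and "m \<in> M"
  shows "a m = 0"
proof -
  obtain k where k: "bij_betw k J {0..<card J}"
    using ex_bij_betw_finite_nat[OF assms(1)] by blast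
  define B where "B = Suc (\<Sum>m\<in>M. \<Sum>p\<in>J. m p)"
  have B: "m p < B" if "m \<in> M" "p \<in> J" for m p
  proof -
    have "m p \<le> (\<Sum>p\<in>J. m p)"
      using that \<open>finite J\<close> by (intro member_le_sum) auto
    also have "\<dots> \<le> (\<Sum>m\<in>M. \<Sum>p\<in>J. m p)"
      using that \<open>finite M\<close> by (intro member_le_sum[of m M "\<lambda>m. \<Sum>p\<in>J. m p"]) auto
    finally show ?thesis by (simp add: B_def)
  qed
  \<comment> \<open>\<open>wt m\<close> is the power of \<open>t\<close> into which the monomial
    \<open>m\<close> turns; its digits in base \<open>B\<close> are the exponents of
    \<open>m\<close>.\<close>
  define wt where "wt m = (\<Sum>p\<in>J. m p * B ^ k p)" for m
  define q where "q = inv_into J k"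
  have q: "bij_betw q {..<card J} J"
    using bij_betw_inv_into[OF k] by (simp add: q_def atLeast0LessThan)
  have kq: "k (q i) = i" if "i < card J" for i
    using k that by (simp add: q_def bij_betw_inv_into_right)
  have wt: "wt m = (\<Sum>i<card J. m (q i) * B ^ i)" for m
    unfolding wt_def sum.reindex_bij_betw[OF q, symmetric] by (simp add: kq)
  have inj: "m = m'" if "m \<in> M" "m' \<in> M" "wt m = wt m'" for m m'
  proof
    fix p show "m p = m' p"
    proof (cases "p \<in> J")
      case True
      then obtain i where i: "i < card J" "p = q i"
        using q by (auto simp: bij_betw_def)
      show ?thesis
        unfolding i(2)
        by (rule digits_unique[of "card J" "\<lambda>i. m (q i)" B "\<lambda>i. m' (q i)"])
          (use that i B q in \<open>auto simp: wt[symmetric] bij_betw_def\<close>)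
    next
      case False
      then show ?thesis using supp[OF that(1)] supp[OF that(2)] by simp
    qed
  qed
  define P where "P = (\<Sum>m\<in>M. monom (a m) (wt m))"
  have "poly P t = 0" for t
  proof -
    have "t ^ wt m = (\<Prod>p\<in>J. (t ^ B ^ k p) ^ m p)" for m
      unfolding wt_def power_sum by (intro prod.cong) (simp_all add: power_mult[symmetric] mult.commute)
    then show ?thesis
      using zero[of "\<lambda>p. t ^ B ^ k p"] by (simp add: P_def poly_sum poly_monom)
  qed
  \<comment> \<open>Characteristic zero makes the field infinite, so a polynomial that vanishes
    everywhere is 0.\<close>
  then have "P = 0" by (simp add: poly_all_0_iff_0[symmetric])
  then have "0 = coeff P (wt m)" by simp
  also have "\<dots> = (\<Sum>m'\<in>M. if m' = m then a m' else 0)"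
    unfolding P_def coeff_sum by (rule sum.cong) (use inj \<open>m \<in> M\<close> in auto)
  also have "\<dots> = a m" using assms by simp
  finally show ?thesis by simp
qed

definition gl_monomial :: "nat \<Rightarrow> (nat \<times> nat \<Rightarrow> nat) \<Rightarrow> 'a::field mat \<Rightarrow> 'a" where
  "gl_monomial d m = on_GL d (\<lambda>g. \<Prod>(i, j)\<in>{1..d} \<times> {1..d}. c_entry d i j g ^ m (i, j))"

definition expset :: "nat \<Rightarrow> nat \<Rightarrow> (nat \<times> nat \<Rightarrow> nat) set" where
  "expset d n = (\<Union>r\<le>n. exponents d r)"

lemma gl_monomial_GL:
  assumes "g \<in> GL d"
  shows "gl_monomial d m g = (\<Prod>(i, j)\<in>{1..d} \<times> {1..d}. g $$ (i - 1, j - 1) ^ m (i, j))"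
  using assms by (simp add: gl_monomial_def on_GL_def c_entry_def)

lemma finite_exponents: "finite (exponents d r)"
proof (rule finite_subset)
  show "exponents d r \<subseteq> {m. \<forall>p. (p \<in> {1..d} \<times> {1..d} \<longrightarrow> m p \<in> {..r}) \<and>
      (p \<notin> {1..d} \<times> {1..d} \<longrightarrow> m p = 0)}"
    by (auto simp: exponents_def intro!: member_le_sum)
  show "finite {m. \<forall>p. (p \<in> {1..d} \<times> {1..d} \<longrightarrow> m p \<in> {..r}) \<and>
      (p \<notin> {1..d} \<times> {1..d} \<longrightarrow> m p = 0)}"
    by (rule finite_set_of_finite_funs) auto
qed

lemma finite_expset: "finite (expset d n)"
  by (simp add: expset_def finite_exponents)

text \<open>For a matrix \<open>h\<close>, the matrix \<open>h + s \<cdot> 1\<close> is invertible for all but finitely many scalars \<open>s\<close>,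
  so a polynomial function that vanishes on \<open>GL d\<close> vanishes at \<open>h\<close>.\<close>

lemma polynomial_zero_off_GL:
  fixes a :: "(nat \<times> nat \<Rightarrow> nat) \<Rightarrow> 'a::field_char_0"
  assumes zero: "\<And>g. g \<in> GL d \<Longrightarrow> (\<Sum>m\<in>M. a m * gl_monomial d m g) = 0"
    and h: "h \<in> carrier_mat d d"
  shows "(\<Sum>m\<in>M. a m * (\<Prod>(i, j)\<in>{1..d} \<times> {1..d}. h $$ (i - 1, j - 1) ^ m (i, j))) = 0"
proof -
  \<comment> \<open>\<open>Q\<close> is the polynomial function along the line
    \<open>h + s * 1\<close>, read as a polynomial in \<open>s\<close>; its value at 0 belongs to
    \<open>h\<close>.\<close>
  define Q where "Q = (\<Sum>m\<in>M. smult (a m) (\<Prod>(i, j)\<in>{1..d} \<times> {1..d}.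
      [:h $$ (i - 1, j - 1), if i = j then 1 else 0:] ^ m (i, j)))"
  have Q: "poly Q s = (\<Sum>m\<in>M. a m * (\<Prod>(i, j)\<in>{1..d} \<times> {1..d}.
      (h $$ (i - 1, j - 1) + s * (if i = j then 1 else 0)) ^ m (i, j)))" for s
    unfolding Q_def poly_sum poly_smult poly_prod by (simp add: case_prod_unfold)
  \<comment> \<open>At \<open>s\<close> the characteristic polynomial of \<open>- h\<close> is the
    determinant of \<open>h + s * 1\<close>. Where it does not vanish the matrix is invertible and
    \<open>Q\<close> vanishes, so the product is 0 everywhere and its monic factor can be
    cancelled.\<close>
  have "poly (Q * char_poly (- h)) s = 0" for s
  proof (cases "poly (char_poly (- h)) s = 0")
    case False
    define g where "g = h + s \<cdot>\<^sub>m 1\<^sub>m d"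
    have g: "g \<in> carrier_mat d d" using h by (simp add: g_def)
    have "- (char_matrix (- h) s) = g"
      using h by (intro eq_matI) (auto simp: char_matrix_def g_def)
    then have "det g \<noteq> 0"
      using False char_poly_matrix[of "- h" d s] h by simp
    then have "g \<in> GL d"
      using g det_non_zero_imp_unit[OF g]
      by (auto simp: GL_def invertible_mat_def inverts_mat_def Units_def ring_mat_def)
    have entry: "g $$ (i - 1, j - 1) = h $$ (i - 1, j - 1) + s * (if i = j then 1 else 0)"
      if "i \<in> {1..d}" "j \<in> {1..d}" for i j
      using that h by (auto simp: g_def)
    have "poly Q s = (\<Sum>m\<in>M. a m * gl_monomial d m g)"
      unfolding Q gl_monomial_GL[OF \<open>g \<in> GL d\<close>]
      by (intro sum.cong arg_cong2[of _ _ _ _ "(*)"] prod.cong refl) (auto simp: entry simp del: One_nat_def)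
    with zero[OF \<open>g \<in> GL d\<close>] show ?thesis by simp
  qed simp
  then have "Q * char_poly (- h) = 0" by (simp only: poly_all_0_iff_0[symmetric] simp_thms)
  moreover have "char_poly (- h) \<noteq> 0"
    using degree_monic_char_poly[of "- h" d] h by auto
  ultimately have "poly Q 0 = 0" by simp
  then show ?thesis by (simp add: Q)
qed

text \<open>A combination that vanishes on \<open>GL d\<close> vanishes at all matrices, and the
  entries of a matrix take arbitrary values, so the independence of ordinary monomials
  applies.\<close>

lemma gl_monomial_independent:
  fixes a :: "(nat \<times> nat \<Rightarrow> nat) \<Rightarrow> 'a::field_char_0"
  assumes "\<And>g. (\<Sum>m\<in>expset d n. a m * gl_monomial d m g) = 0" and "m \<in> expset d n"
  shows "a m = 0"
proof (rule monomials_independent[of "{1..d} \<times> {1..d}" "expset d n"])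
  show "m p = 0" if "m \<in> expset d n" "p \<notin> {1..d} \<times> {1..d}" for m p
    using that by (cases p) (auto simp: expset_def exponents_def)
  fix x :: "nat \<times> nat \<Rightarrow> 'a"
  define h where "h = mat d d (\<lambda>(i, j). x (Suc i, Suc j))"
  have "(\<Sum>m\<in>expset d n. a m * (\<Prod>p\<in>{1..d} \<times> {1..d}. x p ^ m p)) =
      (\<Sum>m\<in>expset d n. a m * (\<Prod>(i, j)\<in>{1..d} \<times> {1..d}. h $$ (i - 1, j - 1) ^ m (i, j)))"
    by (intro sum.cong arg_cong2[of _ _ _ _ "(*)"] prod.cong refl) (auto simp: h_def)
  also have "\<dots> = 0"
    by (rule polynomial_zero_off_GL) (auto simp: assms h_def)
  finally show "(\<Sum>m\<in>expset d n. a m * (\<Prod>p\<in>{1..d} \<times> {1..d}. x p ^ m p)) = 0" .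
qed (use assms finite_expset in auto)

section \<open>Polynomial functions of bounded degree and the linear forms on them\<close>

lemma poly_hom_iff: "f \<in> poly_hom d r \<longleftrightarrow> (\<exists>a. f = (\<lambda>g. \<Sum>m\<in>exponents d r. a m * gl_monomial d m g))"
proof -
  have "on_GL d (\<lambda>g. \<Sum>m\<in>exponents d r.
      a m * (\<Prod>(i, j)\<in>{1..d} \<times> {1..d}. c_entry d i j g ^ m (i, j))) =
    (\<lambda>g. \<Sum>m\<in>exponents d r. a m * gl_monomial d m g)" for a :: "(nat \<times> nat \<Rightarrow> nat) \<Rightarrow> 'a"
    by (auto simp: on_GL_def gl_monomial_def)
  then show ?thesis by (simp add: poly_hom_def)
qed

text \<open>Exponents of different degrees are different, so the sum over the degrees merges into a
  single sum over \<open>expset d n\<close>.\<close>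

lemma poly_upto_iff:
  "f \<in> poly_upto d n \<longleftrightarrow> (\<exists>a. f = (\<lambda>g. \<Sum>m\<in>expset d n. a m * gl_monomial d m g))"
proof
  have *: "(\<Sum>m\<in>expset d n. F m) = (\<Sum>r\<le>n. \<Sum>m\<in>exponents d r. F m)" for F :: "_ \<Rightarrow> 'a"
    unfolding expset_def
    by (rule sum.UNION_disjoint) (auto simp: finite_exponents, auto simp: exponents_def)
  {
    assume "f \<in> poly_upto d n"
    then obtain h where h: "\<And>r. r \<le> n \<Longrightarrow> h r \<in> poly_hom d r" "f = (\<lambda>g. \<Sum>r\<le>n. h r g)"
      by (auto simp: poly_upto_def)
    have "\<forall>r. \<exists>a. r \<le> n \<longrightarrow> h r = (\<lambda>g. \<Sum>m\<in>exponents d r. a m * gl_monomial d m g)"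
      using h(1) by (auto simp: poly_hom_iff)
    then obtain a where a: "\<And>r. r \<le> n \<Longrightarrow> h r = (\<lambda>g. \<Sum>m\<in>exponents d r. a r m * gl_monomial d m g)"
      by metis
    \<comment> \<open>The degree of a monomial is recovered as the sum of its exponents, so one
      coefficient function can select the right \<open>a r\<close>.\<close>
    have "f = (\<lambda>g. \<Sum>m\<in>expset d n. a (\<Sum>p\<in>{1..d} \<times> {1..d}. m p) m * gl_monomial d m g)"
      unfolding h(2) *
      by (intro ext sum.cong refl) (auto simp: a exponents_def intro!: sum.cong)
    then show "\<exists>a. f = (\<lambda>g. \<Sum>m\<in>expset d n. a m * gl_monomial d m g)"
      by (intro exI[of _ "\<lambda>m. a (\<Sum>p\<in>{1..d} \<times> {1..d}. m p) m"])
  }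
  {
    assume "\<exists>a. f = (\<lambda>g. \<Sum>m\<in>expset d n. a m * gl_monomial d m g)"
    then obtain a where a: "f = (\<lambda>g. \<Sum>r\<le>n. \<Sum>m\<in>exponents d r. a m * gl_monomial d m g)"
      by (auto simp: *)
    show "f \<in> poly_upto d n"
      unfolding poly_upto_def
      by (rule CollectI, rule exI[of _ "\<lambda>r g. \<Sum>m\<in>exponents d r. a m * gl_monomial d m g"])
        (auto simp: a poly_hom_iff)
  }
qed

lemma gl_monomial_in_poly_upto:
  assumes "m \<in> expset d n"
  shows "gl_monomial d m \<in> poly_upto d n"
  unfolding poly_upto_iff
proof (intro exI ext)
  show "gl_monomial d m g = (\<Sum>m'\<in>expset d n. (if m' = m then 1 else 0) * gl_monomial d m' g)" for g
    using assms finite_expset[of d n]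
    by (subst sum.remove[of _ m]) (auto intro!: sum.neutral)
qed

lemma poly_upto_0: "(\<lambda>g. 0) \<in> poly_upto d n"
  unfolding poly_upto_iff by (rule exI[of _ "\<lambda>_. 0"]) simp

lemma poly_upto_scale: "f \<in> poly_upto d n \<Longrightarrow> (\<lambda>g. k * f g) \<in> poly_upto d n"
  unfolding poly_upto_iff
  by (elim exE) (rule_tac x = "\<lambda>m. k * a m" in exI, simp add: sum_distrib_left mult_ac)

lemma poly_upto_add:
  "f \<in> poly_upto d n \<Longrightarrow> h \<in> poly_upto d n \<Longrightarrow> (\<lambda>g. f g + h g) \<in> poly_upto d n"
  unfolding poly_upto_iff
  by (elim exE) (rule_tac x = "\<lambda>m. a m + aa m" in exI, simp add: sum.distrib algebra_simps)

text \<open>Linearity of a form is available only inside \<open>poly_upto d n\<close>, so membership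
  of the partial sums is carried through the same induction.\<close>

lemma form_comb:
  assumes "\<xi> \<in> forms d n" "finite A" "\<And>m. m \<in> A \<Longrightarrow> h m \<in> poly_upto d n"
  shows "\<xi> (\<lambda>g. \<Sum>m\<in>A. a m * h m g) = (\<Sum>m\<in>A. a m * \<xi> (h m)) \<and>
    (\<lambda>g. \<Sum>m\<in>A. a m * h m g) \<in> poly_upto d n"
  using assms(2,3)
proof (induction A)
  case empty
  have "\<xi> (\<lambda>g. k * f g) = k * \<xi> f" if "f \<in> poly_upto d n" for k f
    using assms(1) that by (simp add: forms_def)
  from this[OF poly_upto_0, of 0] have "\<xi> (\<lambda>g. 0) = 0" by simp
  then show ?case by (simp add: poly_upto_0)
next
  case (insert m A)
  have "\<xi> (\<lambda>g. a m * h m g + (\<Sum>m\<in>A. a m * h m g)) = \<xi> (\<lambda>g. a m * h m g) + \<xi> (\<lambda>g. \<Sum>m\<in>A. a m * h m g)"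
    using assms(1) insert.IH insert.prems poly_upto_scale[of "h m" d n "a m"] by (simp add: forms_def)
  moreover have "\<xi> (\<lambda>g. a m * h m g) = a m * \<xi> (h m)"
    using assms(1) insert.prems by (simp add: forms_def)
  ultimately show ?case
    using insert poly_upto_scale[of "h m" d n "a m"] poly_upto_add[of "\<lambda>g. a m * h m g" d n]
    by simp
qed

text \<open>The monomials span \<open>poly_upto d n\<close>, and outside this space every form has
  the default value 0.\<close>

lemma forms_eqI:
  assumes "\<xi> \<in> forms d n" "\<eta> \<in> forms d n"
    and "\<And>m. m \<in> expset d n \<Longrightarrow> \<xi> (gl_monomial d m) = \<eta> (gl_monomial d m)"
  shows "\<xi> = \<eta>"
proof
  fix f show "\<xi> f = \<eta> f"
  proof (cases "f \<in> poly_upto d n")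
    case True
    then obtain a where f: "f = (\<lambda>g. \<Sum>m\<in>expset d n. a m * gl_monomial d m g)"
      by (auto simp: poly_upto_iff)
    have "\<zeta> f = (\<Sum>m\<in>expset d n. a m * \<zeta> (gl_monomial d m))" if "\<zeta> \<in> forms d n" for \<zeta>
      unfolding f using form_comb[OF that finite_expset[of d n]] gl_monomial_in_poly_upto by blast
    from this[OF assms(1)] this[OF assms(2)] assms(3) show ?thesis by simp
  qed (use assms(1,2) in \<open>auto simp: forms_def\<close>)
qed

text \<open>Independence makes the coefficients of a polynomial function well defined, so values on
  the monomials can be prescribed freely.\<close>

lemma forms_exists:
  fixes w :: "(nat \<times> nat \<Rightarrow> nat) \<Rightarrow> 'a::field_char_0"
  shows "\<exists>\<xi>\<in>forms d n. \<forall>m\<in>expset d n. \<xi> (gl_monomial d m) = w m"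
proof -
  define lc :: "((nat \<times> nat \<Rightarrow> nat) \<Rightarrow> 'a) \<Rightarrow> 'a mat \<Rightarrow> 'a"
    where "lc a = (\<lambda>g. \<Sum>m\<in>expset d n. a m * gl_monomial d m g)" for a
  \<comment> \<open>The chosen coefficient function is unique only on \<open>expset d n\<close>, but
    the sum looks at no other exponents.\<close>
  define \<xi> where "\<xi> f = (if f \<in> poly_upto d n
    then \<Sum>m\<in>expset d n. (SOME a. f = lc a) m * w m else 0)" for f
  have lc: "f \<in> poly_upto d n \<longleftrightarrow> (\<exists>a. f = lc a)" for f
    by (simp add: poly_upto_iff lc_def)
  have inj: "a m = a' m" if "lc a = lc a'" "m \<in> expset d n" for a a' m
  proof -
    have "a m - a' m = 0"
      by (rule gl_monomial_independent[where a = "\<lambda>m. a m - a' m"])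
        (use that in \<open>auto simp: lc_def fun_eq_iff left_diff_distrib sum_subtractf\<close>)
    then show ?thesis by simp
  qed
  have \<xi>: "\<xi> (lc a) = (\<Sum>m\<in>expset d n. a m * w m)" for a
  proof -
    have "lc a = lc (SOME a'. lc a = lc a')"
      by (rule someI[of "\<lambda>a'. lc a = lc a'", OF refl])
    then have "(SOME a'. lc a = lc a') m = a m" if "m \<in> expset d n" for m
      using inj that by metis
    then show ?thesis using lc by (auto simp: \<xi>_def)
  qed
  have "\<xi> \<in> forms d n"
    unfolding forms_def
  proof (intro CollectI conjI ballI allI impI)
    fix f h :: "'a mat \<Rightarrow> 'a" assume "f \<in> poly_upto d n" "h \<in> poly_upto d n"
    then obtain a a' where *: "f = lc a" "h = lc a'" by (auto simp: lc)
    have "(\<lambda>g. f g + h g) = lc (\<lambda>m. a m + a' m)"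
      by (auto simp: * lc_def sum.distrib algebra_simps)
    then show "\<xi> (\<lambda>g. f g + h g) = \<xi> f + \<xi> h"
      by (simp add: * \<xi> sum.distrib algebra_simps)
  next
    fix k and f :: "'a mat \<Rightarrow> 'a" assume "f \<in> poly_upto d n"
    then obtain a where *: "f = lc a" by (auto simp: lc)
    have "(\<lambda>g. k * f g) = lc (\<lambda>m. k * a m)"
      by (auto simp: * lc_def sum_distrib_left mult_ac)
    then show "\<xi> (\<lambda>g. k * f g) = k * \<xi> f"
      by (simp add: * \<xi> sum_distrib_left mult_ac)
  qed (simp add: \<xi>_def)
  moreover have "\<xi> (gl_monomial d m) = w m" if "m \<in> expset d n" for m
  proof -
    have "gl_monomial d m = lc (\<lambda>m'. if m' = m then 1 else 0)"
      unfolding lc_def using that finite_expset[of d n]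
      by (intro ext, subst sum.remove[of _ m]) (auto intro!: sum.neutral)
    then have "\<xi> (gl_monomial d m) = (\<Sum>m'\<in>expset d n. (if m' = m then 1 else 0) * w m')"
      by (simp add: \<xi>)
    also have "\<dots> = w m"
      using that finite_expset[of d n] by (subst sum.remove[of _ m]) (auto intro!: sum.neutral)
    finally show ?thesis .
  qed
  ultimately show ?thesis by blast
qed

section \<open>Monomials indexed by pairs of partial maps\<close>

text \<open>This is the exponent function of \<open>cc d \<alpha> \<beta>\<close>: it records the
  multiset of index pairs and forgets the places at which they stand.\<close>

definition mexp :: "(nat \<rightharpoonup> nat) \<Rightarrow> (nat \<rightharpoonup> nat) \<Rightarrow> nat \<times> nat \<Rightarrow> nat" where
  "mexp \<alpha> \<beta> p = card {x \<in> dom \<alpha>. (the (\<alpha> x), the (\<beta> x)) = p}"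

lemma Gam_pair:
  assumes "\<alpha> \<in> Gam X d" "\<beta> \<in> Gam X d" "x \<in> X"
  shows "(the (\<alpha> x), the (\<beta> x)) \<in> {1..d} \<times> {1..d}"
proof -
  have "the (\<gamma> x) \<in> {1..d}" if "\<gamma> \<in> Gam X d" for \<gamma>
    using that assms(3) by (auto simp: Gam_def dom_def ran_def)
  with assms show ?thesis by blast
qed

text \<open>Grouping the factors by their index pair turns the product over \<open>X\<close> into a
  product of powers.\<close>

lemma cc_eq_gl_monomial:
  assumes "\<alpha> \<in> Gam X d" "\<beta> \<in> Gam X d" "finite X"
  shows "cc d \<alpha> \<beta> = gl_monomial d (mexp \<alpha> \<beta>)"
proof
  fix g
  let ?J = "{1..d} \<times> {1..d}" and ?q = "\<lambda>x. (the (\<alpha> x), the (\<beta> x))"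
  let ?c = "\<lambda>p. c_entry d (fst p) (snd p) g"
  have X: "dom \<alpha> = X" using assms by (simp add: Gam_def)
  have "(\<Prod>x\<in>X. ?c (?q x)) = (\<Prod>p\<in>?J. \<Prod>x\<in>{x \<in> X. ?q x = p}. ?c (?q x))"
    by (rule prod.group[symmetric]) (use assms Gam_pair[OF assms(1,2)] in auto)
  also have "\<dots> = (\<Prod>p\<in>?J. ?c p ^ mexp \<alpha> \<beta> p)"
    unfolding mexp_def X by (intro prod.cong refl) simp
  finally show "cc d \<alpha> \<beta> g = gl_monomial d (mexp \<alpha> \<beta>) g"
    by (simp add: cc_def gl_monomial_def on_GL_def X case_prod_unfold)
qed

lemma mexp_in_expset:
  assumes "\<alpha> \<in> Gam X d" "\<beta> \<in> Gam X d" "X \<subseteq> {1..n}"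
  shows "mexp \<alpha> \<beta> \<in> expset d n"
proof -
  let ?J = "{1..d} \<times> {1..d}" and ?q = "\<lambda>x. (the (\<alpha> x), the (\<beta> x))"
  have X: "dom \<alpha> = X" using assms by (simp add: Gam_def)
  have fin: "finite X" using assms(3) finite_subset by blast
  have "(\<Sum>x\<in>X. 1) = (\<Sum>p\<in>?J. \<Sum>x\<in>{x \<in> X. ?q x = p}. 1 :: nat)"
    by (rule sum.group[symmetric]) (use fin Gam_pair[OF assms(1,2)] in auto)
  then have "(\<Sum>p\<in>?J. mexp \<alpha> \<beta> p) = card X"
    by (simp add: mexp_def X)
  moreover have "card X \<le> n"
    using card_mono[OF _ assms(3)] by simp
  moreover have "mexp \<alpha> \<beta> p = 0" if "p \<notin> ?J" for p
  proof -
    have "{x \<in> X. ?q x = p} = {}" using Gam_pair[OF assms(1,2)] that by blast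
    then show ?thesis unfolding mexp_def X by (simp only: card.empty)
  qed
  ultimately show ?thesis
    unfolding expset_def exponents_def by blast
qed

text \<open>The exponents form a multiset of at most \<open>n\<close> pairs. Listing it and
  separating the components of the entries gives \<open>\<alpha>\<close> and \<open>\<beta>\<close>
  on an initial segment of \<open>{1..n}\<close>.\<close>

lemma expset_mexp:
  assumes "m \<in> expset d n"
  shows "\<exists>X\<subseteq>{1..n}. \<exists>\<alpha>\<in>Gam X d. \<exists>\<beta>\<in>Gam X d. m = mexp \<alpha> \<beta>"
proof -
  let ?J = "{1..d} \<times> {1..d}"
  have m: "\<And>p. p \<notin> ?J \<Longrightarrow> m p = 0" "(\<Sum>p\<in>?J. m p) \<le> n"
    using assms unfolding expset_def exponents_def by blast+
  define A where "A = (\<Sum>p\<in>?J. replicate_mset (m p) p)"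
  have count: "count A p = m p" for p
  proof -
    have "count A p = (\<Sum>q\<in>?J. if q = p then m p else 0)"
      unfolding A_def count_sum by (intro sum.cong) auto
    then show ?thesis using m(1)[of p] by (simp add: sum.delta)
  qed
  have size: "size A \<le> n" using m(2) by (simp add: A_def size_multiset_sum)
  obtain ps where ps: "mset ps = A" using ex_mset by blast
  \<comment> \<open>List positions start from 0 and places from 1, hence the shift.\<close>
  define q where "q x = (if x \<in> {1..length ps} then Some (ps ! (x - 1)) else None)" for x
  have set: "set ps \<subseteq> ?J"
  proof
    fix p assume "p \<in> set ps"
    then have "p \<in># A" by (simp add: ps[symmetric])
    then have "m p \<noteq> 0" using count[of p] by (metis not_in_iff)
    then show "p \<in> ?J" using m(1)[of p] by (rule contrapos_np)
  qed
  have q: "p \<in> ?J" if "q x = Some p" for x p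
    using that set by (auto simp: q_def split: if_splits intro!: nth_mem)
  let ?\<alpha> = "map_option fst \<circ> q" and ?\<beta> = "map_option snd \<circ> q" and ?X = "{1..length ps}"
  have "dom q = ?X" by (auto simp: q_def dom_def split: if_splits)
  then have dom: "dom ?\<alpha> = ?X" "dom ?\<beta> = ?X" by (auto simp: dom_def)
  have "?\<alpha> \<in> Gam ?X d" "?\<beta> \<in> Gam ?X d"
    using dom q by (auto simp: Gam_def ran_def)
  moreover have "?X \<subseteq> {1..n}"
    using size by (auto simp: ps[symmetric])
  moreover have "m = mexp ?\<alpha> ?\<beta>"
  proof
    fix p
    have "{x \<in> ?X. (the (?\<alpha> x), the (?\<beta> x)) = p} = {x \<in> Suc ` {..<length ps}. ps ! (x - 1) = p}"
      by (rule Collect_cong) (auto simp: q_def image_Suc_lessThan)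
    also have "\<dots> = Suc ` {i. i < length ps \<and> ps ! i = p}"
      by auto
    finally have "mexp ?\<alpha> ?\<beta> p = card {i. i < length ps \<and> ps ! i = p}"
      unfolding mexp_def dom by (simp add: card_image)
    also have "\<dots> = count (mset ps) p"
      by (simp add: count_mset count_list_eq_length_filter length_filter_conv_card eq_commute)
    finally show "m p = mexp ?\<alpha> ?\<beta> p" by (simp add: ps count)
  qed
  ultimately show ?thesis by blast
qed

section \<open>Relabelling pairs of indices by rook elements\<close>

lemma rookD:
  assumes "\<sigma> \<in> rook n"
  shows "dom \<sigma> \<subseteq> {1..n}" "ran \<sigma> \<subseteq> {1..n}" "inj_on \<sigma> (dom \<sigma>)"
  using assms by (auto simp: rook_def)

lemma finite_rook: "finite (rook n)"
proof (rule finite_subset)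
  show "rook n \<subseteq> T_index n n" by (auto simp: rook_def T_index_iff)
qed (rule finite_T_index)

lemma rook_inj:
  assumes "\<sigma> \<in> rook n" "\<sigma> i = Some x" "\<sigma> j = Some x"
  shows "i = j"
  using assms rookD(3)[OF assms(1)] by (auto simp: inj_on_def dom_def)

lemma dom_comp: "dom (\<alpha> \<circ>\<^sub>m \<pi>) = {i. \<exists>x\<in>dom \<alpha>. \<pi> i = Some x}"
  by (auto simp: map_comp_def dom_def split: option.splits)

lemma ran_comp: "ran (\<alpha> \<circ>\<^sub>m \<pi>) \<subseteq> ran \<alpha>"
  by (auto simp: map_comp_def ran_def split: option.splits)

lemma map_comp_assoc: "(\<alpha> \<circ>\<^sub>m \<beta>) \<circ>\<^sub>m \<gamma> = \<alpha> \<circ>\<^sub>m (\<beta> \<circ>\<^sub>m \<gamma>)"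
  by (auto simp: map_comp_def fun_eq_iff split: option.splits)

lemma Gam_comp:
  assumes "\<alpha> \<in> Gam X d" "\<beta> \<in> Gam X d"
  shows "\<alpha> \<circ>\<^sub>m \<pi> \<in> Gam (dom (\<beta> \<circ>\<^sub>m \<pi>)) d"
  using assms ran_comp[of \<alpha> \<pi>] by (auto simp: Gam_def dom_comp)

text \<open>Composition with \<open>\<pi>\<close> loses information only off the range of
  \<open>\<pi>\<close>, where neither map is defined.\<close>

lemma comp_inj:
  assumes "dom \<alpha> \<subseteq> ran \<pi>" "dom \<beta> \<subseteq> ran \<pi>" "\<alpha> \<circ>\<^sub>m \<pi> = \<beta> \<circ>\<^sub>m \<pi>"
  shows "\<alpha> = \<beta>"
proof
  fix x show "\<alpha> x = \<beta> x"
  proof (cases "x \<in> ran \<pi>")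
    case True
    then obtain i where "\<pi> i = Some x" by (auto simp: ran_def)
    with fun_cong[OF assms(3), of i] show ?thesis by (simp add: map_comp_def)
  next
    case False
    then have "x \<notin> dom \<alpha>" "x \<notin> dom \<beta>" using assms by blast+
    then show ?thesis by (simp add: domIff)
  qed
qed

text \<open>The inverse composes with the inverse of \<open>\<pi>\<close> on \<open>X\<close>. The
  new domain is the preimage of \<open>X\<close> under \<open>\<pi>\<close>; it is expressed through
  one \<open>\<beta>\<close>, since all maps with domain \<open>X\<close> give the same one.\<close>

lemma bij_betw_Gam_comp:
  assumes "\<pi> \<in> rook n" "\<beta> \<in> Gam X d" "X \<subseteq> ran \<pi>"
  shows "bij_betw (\<lambda>\<alpha>. \<alpha> \<circ>\<^sub>m \<pi>) (Gam X d) (Gam (dom (\<beta> \<circ>\<^sub>m \<pi>)) d)"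
  unfolding bij_betw_def
proof
  show "inj_on (\<lambda>\<alpha>. \<alpha> \<circ>\<^sub>m \<pi>) (Gam X d)"
  proof (rule inj_onI)
    show "\<alpha> = \<alpha>'" if "\<alpha> \<in> Gam X d" "\<alpha>' \<in> Gam X d" "\<alpha> \<circ>\<^sub>m \<pi> = \<alpha>' \<circ>\<^sub>m \<pi>" for \<alpha> \<alpha>'
      by (rule comp_inj[of \<alpha> \<pi> \<alpha>']) (use that assms(3) in \<open>auto simp: Gam_def\<close>)
  qed
  show "(\<lambda>\<alpha>. \<alpha> \<circ>\<^sub>m \<pi>) ` Gam X d = Gam (dom (\<beta> \<circ>\<^sub>m \<pi>)) d"
  proof
    show "(\<lambda>\<alpha>. \<alpha> \<circ>\<^sub>m \<pi>) ` Gam X d \<subseteq> Gam (dom (\<beta> \<circ>\<^sub>m \<pi>)) d"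
      using Gam_comp[OF _ assms(2)] by blast
    show "Gam (dom (\<beta> \<circ>\<^sub>m \<pi>)) d \<subseteq> (\<lambda>\<alpha>. \<alpha> \<circ>\<^sub>m \<pi>) ` Gam X d"
    proof
      fix \<delta> assume \<delta>: "\<delta> \<in> Gam (dom (\<beta> \<circ>\<^sub>m \<pi>)) d"
      have X: "dom \<beta> = X" using assms(2) by (simp add: Gam_def)
      define \<alpha> where "\<alpha> x = (if x \<in> X then \<delta> (THE i. \<pi> i = Some x) else None)" for x
      have \<alpha>: "\<alpha> x = \<delta> i" if "\<pi> i = Some x" "x \<in> X" for i x
      proof -
        have "(THE i. \<pi> i = Some x) = i"
          using that(1) rook_inj[OF assms(1)] by blast
        with that show ?thesis by (simp add: \<alpha>_def)
      qed
      have dom\<delta>: "i \<in> dom \<delta> \<longleftrightarrow> (\<exists>x\<in>X. \<pi> i = Some x)" for i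
        using \<delta> by (auto simp: Gam_def dom_comp X)
      have "\<alpha> \<circ>\<^sub>m \<pi> = \<delta>"
      proof
        fix i show "(\<alpha> \<circ>\<^sub>m \<pi>) i = \<delta> i"
        proof (cases "i \<in> dom \<delta>")
          case True
          then obtain x where "x \<in> X" "\<pi> i = Some x" using dom\<delta> by blast
          then show ?thesis by (simp add: \<alpha>)
        next
          case False
          then show ?thesis
            using dom\<delta>[of i] by (cases "\<pi> i") (auto simp: \<alpha>_def domIff)
        qed
      qed
      moreover have "\<alpha> \<in> Gam X d"
      proof -
        have "dom \<alpha> = X"
        proof
          show "dom \<alpha> \<subseteq> X" by (auto simp: \<alpha>_def split: if_splits)
          show "X \<subseteq> dom \<alpha>"
          proof
            fix x assume x: "x \<in> X"
            then obtain i where i: "\<pi> i = Some x" using assms(3) by (auto simp: ran_def)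
            then have "i \<in> dom \<delta>" using dom\<delta> x by blast
            then show "x \<in> dom \<alpha>" using \<alpha>[OF i x] by (simp add: domIff)
          qed
        qed
        moreover have "ran \<alpha> \<subseteq> ran \<delta>"
          by (auto simp: \<alpha>_def ran_def split: if_splits)
        ultimately show ?thesis using \<delta> by (auto simp: Gam_def)
      qed
      ultimately show "\<delta> \<in> (\<lambda>\<alpha>. \<alpha> \<circ>\<^sub>m \<pi>) ` Gam X d" by blast
    qed
  qed
qed

text \<open>\<open>\<pi>\<close> merely moves the places of the index pairs, bijectively because it
  is injective and covers \<open>X\<close>.\<close>

lemma mexp_comp:
  assumes "\<pi> \<in> rook n" "\<alpha> \<in> Gam X d" "\<beta> \<in> Gam X d" "X \<subseteq> ran \<pi>"
  shows "mexp (\<alpha> \<circ>\<^sub>m \<pi>) (\<beta> \<circ>\<^sub>m \<pi>) = mexp \<alpha> \<beta>"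
proof
  fix p
  let ?A = "{i \<in> dom (\<alpha> \<circ>\<^sub>m \<pi>). (the ((\<alpha> \<circ>\<^sub>m \<pi>) i), the ((\<beta> \<circ>\<^sub>m \<pi>) i)) = p}"
  let ?B = "{x \<in> dom \<alpha>. (the (\<alpha> x), the (\<beta> x)) = p}"
  have X: "dom \<alpha> = X" using assms(2) by (simp add: Gam_def)
  have "bij_betw (\<lambda>i. the (\<pi> i)) ?A ?B"
    unfolding bij_betw_def
  proof
    show "inj_on (\<lambda>i. the (\<pi> i)) ?A"
      by (rule inj_onI) (auto simp: dom_comp intro: rook_inj[OF assms(1)])
    show "(\<lambda>i. the (\<pi> i)) ` ?A = ?B"
    proof
      show "(\<lambda>i. the (\<pi> i)) ` ?A \<subseteq> ?B" by (auto simp: dom_comp)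
      show "?B \<subseteq> (\<lambda>i. the (\<pi> i)) ` ?A"
      proof
        fix x assume x: "x \<in> ?B"
        then obtain i where i: "\<pi> i = Some x" using assms(4) X by (auto simp: ran_def)
        then have "i \<in> ?A" using x by (auto simp: dom_comp)
        then show "x \<in> (\<lambda>i. the (\<pi> i)) ` ?A"
          by (intro image_eqI[of _ _ i]) (simp_all add: i)
      qed
    qed
  qed
  then show "mexp (\<alpha> \<circ>\<^sub>m \<pi>) (\<beta> \<circ>\<^sub>m \<pi>) p = mexp \<alpha> \<beta> p"
    unfolding mexp_def by (rule bij_betw_same_card)
qed

text \<open>Each index pair occurs equally often on both sides, so there are bijections between the
  fibres over the single pairs, and these glue to \<open>\<pi>\<close>. As the converse of
  \<open>mexp_comp\<close>, this shows that a monomial determines its pair of indices up to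
  relabelling.\<close>

lemma mexp_eqD:
  assumes "\<alpha> \<in> Gam X d" "\<beta> \<in> Gam X d" "\<alpha>' \<in> Gam Y d" "\<beta>' \<in> Gam Y d"
    and "X \<subseteq> {1..n}" "Y \<subseteq> {1..n}" "mexp \<alpha>' \<beta>' = mexp \<alpha> \<beta>"
  shows "\<exists>\<pi>\<in>rook n. ran \<pi> = X \<and> \<alpha>' = \<alpha> \<circ>\<^sub>m \<pi> \<and> \<beta>' = \<beta> \<circ>\<^sub>m \<pi>"
proof -
  let ?p = "\<lambda>x. (the (\<alpha> x), the (\<beta> x))" and ?q = "\<lambda>y. (the (\<alpha>' y), the (\<beta>' y))"
  have dom: "dom \<alpha> = X" "dom \<beta> = X" "dom \<alpha>' = Y" "dom \<beta>' = Y"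
    using assms by (auto simp: Gam_def)
  have "\<exists>h. bij_betw h {y \<in> Y. ?q y = p} {x \<in> X. ?p x = p}" for p
  proof (rule finite_same_card_bij)
    show "finite {y \<in> Y. ?q y = p}" "finite {x \<in> X. ?p x = p}"
      using assms(5,6) finite_subset by fastforce+
    show "card {y \<in> Y. ?q y = p} = card {x \<in> X. ?p x = p}"
      using fun_cong[OF assms(7), of p] by (simp add: mexp_def dom)
  qed
  then have "\<exists>h. \<forall>p. bij_betw (h p) {y \<in> Y. ?q y = p} {x \<in> X. ?p x = p}"
    by (intro choice allI)
  then obtain h where h: "\<And>p. bij_betw (h p) {y \<in> Y. ?q y = p} {x \<in> X. ?p x = p}"
    by blast
  define f where "f y = h (?q y) y" for y
  have f: "f y \<in> X" "?p (f y) = ?q y" if "y \<in> Y" for y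
    using bij_betwE[OF h[of "?q y"]] that by (auto simp: f_def)
  have inj: "y = y'" if "y \<in> Y" "y' \<in> Y" "f y = f y'" for y y'
  proof -
    have q: "?q y = ?q y'" using f(2)[OF that(1)] f(2)[OF that(2)] that(3) by simp
    show ?thesis
    proof (rule inj_onD[OF bij_betw_imp_inj_on[OF h[of "?q y"]]])
      show "h (?q y) y = h (?q y) y'" using that(3) q unfolding f_def by simp
    qed (use that q in simp_all)
  qed
  have surj: "\<exists>y\<in>Y. f y = x" if "x \<in> X" for x
  proof -
    have "x \<in> h (?p x) ` {y \<in> Y. ?q y = ?p x}"
      using bij_betw_imp_surj_on[OF h[of "?p x"]] that by simp
    then obtain y where "y \<in> Y" "?q y = ?p x" "x = h (?p x) y" by blast
    then show ?thesis unfolding f_def by (intro bexI[of _ y]) simp_all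
  qed
  define \<pi> where "\<pi> y = (if y \<in> Y then Some (f y) else None)" for y
  have dom\<pi>: "dom \<pi> = Y" by (auto simp: \<pi>_def split: if_splits)
  have ran\<pi>: "ran \<pi> = X"
  proof
    show "ran \<pi> \<subseteq> X" using f(1) by (auto simp: \<pi>_def ran_def split: if_splits)
    show "X \<subseteq> ran \<pi>"
    proof
      fix x assume "x \<in> X"
      then obtain y where "y \<in> Y" "f y = x" using surj by blast
      then have "\<pi> y = Some x" by (simp add: \<pi>_def)
      then show "x \<in> ran \<pi>" by (rule ranI)
    qed
  qed
  have "\<pi> \<in> rook n"
    using dom\<pi> ran\<pi> assms(5,6) inj by (auto simp: rook_def inj_on_def \<pi>_def split: if_splits)
  moreover have comp: "\<gamma>' = \<gamma> \<circ>\<^sub>m \<pi>"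
    if "dom \<gamma>' = Y" "dom \<gamma> = X" "\<And>y. y \<in> Y \<Longrightarrow> the (\<gamma> (f y)) = the (\<gamma>' y)" for \<gamma> \<gamma>'
  proof
    fix y show "\<gamma>' y = (\<gamma> \<circ>\<^sub>m \<pi>) y"
    proof (cases "y \<in> Y")
      case True
      then have "\<gamma>' y \<noteq> None" "\<gamma> (f y) \<noteq> None" using that(1,2) f(1)[OF True] by blast+
      then show ?thesis using that(3)[OF True] True by (auto simp: \<pi>_def)
    next
      case False
      then have "y \<notin> dom \<gamma>'" using that(1) by simp
      then show ?thesis using False by (simp add: \<pi>_def domIff map_comp_def)
    qed
  qed
  moreover have "\<alpha>' = \<alpha> \<circ>\<^sub>m \<pi>" "\<beta>' = \<beta> \<circ>\<^sub>m \<pi>"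
    using f(2) by (auto intro: comp[OF dom(3,1)] comp[OF dom(4,2)])
  ultimately show ?thesis using ran\<pi> by blast
qed

lemma cc_comp:
  assumes "\<pi> \<in> rook n" "\<alpha> \<in> Gam X d" "\<beta> \<in> Gam X d" "X \<subseteq> ran \<pi>"
  shows "cc d (\<alpha> \<circ>\<^sub>m \<pi>) (\<beta> \<circ>\<^sub>m \<pi>) = cc d \<alpha> \<beta>"
proof -
  have fin: "finite X" "finite (dom (\<alpha> \<circ>\<^sub>m \<pi>))"
  proof -
    show "finite X" using assms(4) rookD(2)[OF assms(1)] by (meson finite_atLeastAtMost finite_subset)
    have "dom (\<alpha> \<circ>\<^sub>m \<pi>) \<subseteq> {1..n}" using rookD(1)[OF assms(1)] by (auto simp: dom_comp)
    then show "finite (dom (\<alpha> \<circ>\<^sub>m \<pi>))" using finite_subset by blast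
  qed
  show ?thesis
    unfolding cc_eq_gl_monomial[OF Gam_comp[OF assms(2,2)] Gam_comp[OF assms(3,2)] fin(2)]
      cc_eq_gl_monomial[OF assms(2,3) fin(1)] mexp_comp[OF assms] ..
qed

section \<open>Forms given by invariant matrices; the product and the unit\<close>

lemma forms_cc_eqI:
  assumes "\<xi> \<in> forms d n" "\<eta> \<in> forms d n"
    and "\<And>X \<alpha> \<beta>. \<lbrakk>X \<subseteq> {1..n}; \<alpha> \<in> Gam X d; \<beta> \<in> Gam X d\<rbrakk> \<Longrightarrow> \<xi> (cc d \<alpha> \<beta>) = \<eta> (cc d \<alpha> \<beta>)"
  shows "\<xi> = \<eta>"
proof (rule forms_eqI[OF assms(1,2)])
  fix m assume "m \<in> expset d n"
  then obtain X \<alpha> \<beta> where *: "X \<subseteq> {1..n}" "\<alpha> \<in> Gam X d" "\<beta> \<in> Gam X d" "m = mexp \<alpha> \<beta>"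
    using expset_mexp by blast
  then have "finite X" using finite_subset by blast
  then show "\<xi> (gl_monomial d m) = \<eta> (gl_monomial d m)"
    using assms(3)[OF *(1-3)] *(4) by (simp add: cc_eq_gl_monomial[OF *(2,3)])
qed

text \<open>By \<open>mexp_eqD\<close> an invariant matrix depends only on the monomial of the pair,
  and values on the monomials can be prescribed.\<close>

lemma forms_of_invariant:
  fixes M :: "(nat \<rightharpoonup> nat) \<Rightarrow> (nat \<rightharpoonup> nat) \<Rightarrow> 'a::field_char_0"
  assumes inv: "\<And>X \<alpha> \<beta> \<pi>. \<lbrakk>X \<subseteq> {1..n}; \<alpha> \<in> Gam X d; \<beta> \<in> Gam X d; \<pi> \<in> rook n; ran \<pi> = X\<rbrakk>
    \<Longrightarrow> M (\<alpha> \<circ>\<^sub>m \<pi>) (\<beta> \<circ>\<^sub>m \<pi>) = M \<alpha> \<beta>"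
  shows "\<exists>\<xi>\<in>forms d n. \<forall>X\<subseteq>{1..n}. \<forall>\<alpha>\<in>Gam X d. \<forall>\<beta>\<in>Gam X d. \<xi> (cc d \<alpha> \<beta>) = M \<alpha> \<beta>"
proof -
  define P where "P m z \<longleftrightarrow>
    (\<exists>X\<subseteq>{1..n}. fst z \<in> Gam X d \<and> snd z \<in> Gam X d \<and> m = mexp (fst z) (snd z))" for m z
  \<comment> \<open>\<open>w\<close> reads \<open>M\<close> at an arbitrary pair representing
    \<open>m\<close>; invariance makes the choice harmless.\<close>
  define w where "w m = (let z = SOME z. P m z in M (fst z) (snd z))" for m
  obtain \<xi> where \<xi>: "\<xi> \<in> forms d n" "\<And>m. m \<in> expset d n \<Longrightarrow> \<xi> (gl_monomial d m) = w m"
    using forms_exists[of d n w] by blast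
  have "\<xi> (cc d \<alpha> \<beta>) = M \<alpha> \<beta>" if X: "X \<subseteq> {1..n}" and \<alpha>: "\<alpha> \<in> Gam X d" and \<beta>: "\<beta> \<in> Gam X d" for X \<alpha> \<beta>
  proof -
    let ?m = "mexp \<alpha> \<beta>"
    define z where "z = (SOME z. P ?m z)"
    have "P ?m (\<alpha>, \<beta>)" using that by (auto simp: P_def)
    then have "P ?m z" unfolding z_def by (rule someI)
    then obtain Y where "Y \<subseteq> {1..n}" "fst z \<in> Gam Y d" "snd z \<in> Gam Y d" "mexp (fst z) (snd z) = ?m"
      by (auto simp: P_def)
    then obtain \<pi> where \<pi>: "\<pi> \<in> rook n" "ran \<pi> = X" "fst z = \<alpha> \<circ>\<^sub>m \<pi>" "snd z = \<beta> \<circ>\<^sub>m \<pi>"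
      using mexp_eqD[OF \<alpha> \<beta> _ _ X] by metis
    have "finite X" using X finite_subset by blast
    then have "\<xi> (cc d \<alpha> \<beta>) = w ?m"
      using \<xi>(2)[OF mexp_in_expset[OF \<alpha> \<beta> X]] by (simp add: cc_eq_gl_monomial[OF \<alpha> \<beta>])
    also have "\<dots> = M (\<alpha> \<circ>\<^sub>m \<pi>) (\<beta> \<circ>\<^sub>m \<pi>)" by (simp add: w_def Let_def \<pi> z_def[symmetric])
    also have "\<dots> = M \<alpha> \<beta>" by (rule inv[OF X \<alpha> \<beta> \<pi>(1,2)])
    finally show ?thesis .
  qed
  with \<xi>(1) show ?thesis by blast
qed

text \<open>The definite description needs existence and uniqueness. Relabelling permutes the
  summation index \<open>\<gamma>\<close> and keeps the monomials, so the right-hand side is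
  invariant; the monomials span, so the form is unique.\<close>

lemma schur_mult:
  fixes \<xi> \<eta> :: "('a::field_char_0 mat \<Rightarrow> 'a) \<Rightarrow> 'a"
  shows "schur_mult d n \<xi> \<eta> \<in> forms d n"
    and "\<lbrakk>X \<subseteq> {1..n}; \<alpha> \<in> Gam X d; \<beta> \<in> Gam X d\<rbrakk> \<Longrightarrow>
      schur_mult d n \<xi> \<eta> (cc d \<alpha> \<beta>) = (\<Sum>\<gamma>\<in>Gam X d. \<xi> (cc d \<alpha> \<gamma>) * \<eta> (cc d \<gamma> \<beta>))"
proof -
  let ?M = "\<lambda>\<alpha> \<beta>. \<Sum>\<gamma>\<in>Gam (dom \<alpha>) d. \<xi> (cc d \<alpha> \<gamma>) * \<eta> (cc d \<gamma> \<beta>)"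
  let ?P = "\<lambda>\<zeta>. \<zeta> \<in> forms d n \<and> (\<forall>X\<subseteq>{1..n}. \<forall>\<alpha>\<in>Gam X d. \<forall>\<beta>\<in>Gam X d.
      \<zeta> (cc d \<alpha> \<beta>) = (\<Sum>\<gamma>\<in>Gam X d. \<xi> (cc d \<alpha> \<gamma>) * \<eta> (cc d \<gamma> \<beta>)))"
  have "\<exists>\<zeta>\<in>forms d n. \<forall>X\<subseteq>{1..n}. \<forall>\<alpha>\<in>Gam X d. \<forall>\<beta>\<in>Gam X d. \<zeta> (cc d \<alpha> \<beta>) = ?M \<alpha> \<beta>"
  proof (rule forms_of_invariant)
    fix X \<alpha> \<beta> \<pi>
    assume *: "X \<subseteq> {1..n}" "\<alpha> \<in> Gam X d" "\<beta> \<in> Gam X d" "\<pi> \<in> rook n" "ran \<pi> = X"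
    have X: "dom \<alpha> = X" using * by (simp add: Gam_def)
    have cc: "cc d (\<gamma> \<circ>\<^sub>m \<pi>) (\<gamma>' \<circ>\<^sub>m \<pi>) = cc d \<gamma> \<gamma>'" if "\<gamma> \<in> Gam X d" "\<gamma>' \<in> Gam X d" for \<gamma> \<gamma>'
      using cc_comp[OF *(4) that] *(5) by simp
    have "?M (\<alpha> \<circ>\<^sub>m \<pi>) (\<beta> \<circ>\<^sub>m \<pi>) =
        (\<Sum>\<gamma>\<in>Gam X d. \<xi> (cc d (\<alpha> \<circ>\<^sub>m \<pi>) (\<gamma> \<circ>\<^sub>m \<pi>)) * \<eta> (cc d (\<gamma> \<circ>\<^sub>m \<pi>) (\<beta> \<circ>\<^sub>m \<pi>)))"
      by (rule sum.reindex_bij_betw[symmetric, OF bij_betw_Gam_comp[OF *(4,2)]]) (simp add: *)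
    also have "\<dots> = ?M \<alpha> \<beta>"
      unfolding X by (rule sum.cong) (simp_all add: cc *)
    finally show "?M (\<alpha> \<circ>\<^sub>m \<pi>) (\<beta> \<circ>\<^sub>m \<pi>) = ?M \<alpha> \<beta>" .
  qed
  then obtain \<zeta> where \<zeta>: "?P \<zeta>" by (auto simp: Gam_def)
  have "?P (schur_mult d n \<xi> \<eta>)"
    unfolding schur_mult_def
  proof (rule theI[of ?P, OF \<zeta>])
    show "\<zeta>' = \<zeta>" if "?P \<zeta>'" for \<zeta>'
      using that \<zeta> by (intro forms_cc_eqI[of _ d n]) auto
  qed
  then show "schur_mult d n \<xi> \<eta> \<in> forms d n"
    and "\<lbrakk>X \<subseteq> {1..n}; \<alpha> \<in> Gam X d; \<beta> \<in> Gam X d\<rbrakk> \<Longrightarrow>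
      schur_mult d n \<xi> \<eta> (cc d \<alpha> \<beta>) = (\<Sum>\<gamma>\<in>Gam X d. \<xi> (cc d \<alpha> \<gamma>) * \<eta> (cc d \<gamma> \<beta>))"
    by blast+
qed

text \<open>Relabelling by a \<open>\<pi>\<close> onto the common domain preserves both equality and
  inequality of indices, so the Kronecker delta is invariant.\<close>

lemma schur_one:
  shows "(schur_one d n :: ('a::field_char_0 mat \<Rightarrow> 'a) \<Rightarrow> 'a) \<in> forms d n"
    and "\<lbrakk>X \<subseteq> {1..n}; \<alpha> \<in> Gam X d; \<beta> \<in> Gam X d\<rbrakk> \<Longrightarrow>
      (schur_one d n :: ('a mat \<Rightarrow> 'a) \<Rightarrow> 'a) (cc d \<alpha> \<beta>) = (if \<alpha> = \<beta> then 1 else 0)"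
proof -
  let ?P = "\<lambda>\<zeta> :: ('a mat \<Rightarrow> 'a) \<Rightarrow> 'a. \<zeta> \<in> forms d n \<and>
    (\<forall>X\<subseteq>{1..n}. \<forall>\<alpha>\<in>Gam X d. \<forall>\<beta>\<in>Gam X d. \<zeta> (cc d \<alpha> \<beta>) = (if \<alpha> = \<beta> then 1 else 0))"
  have "\<exists>\<zeta>\<in>forms d n. \<forall>X\<subseteq>{1..n}. \<forall>\<alpha>\<in>Gam X d. \<forall>\<beta>\<in>Gam X d.
      \<zeta> (cc d \<alpha> \<beta>) = (if \<alpha> = \<beta> then 1 else (0::'a))"
  proof (rule forms_of_invariant)
    fix X \<alpha> \<beta> \<pi>
    assume *: "\<alpha> \<in> Gam X d" "\<beta> \<in> Gam X d" "ran \<pi> = X"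
    have "\<alpha> \<circ>\<^sub>m \<pi> = \<beta> \<circ>\<^sub>m \<pi> \<longleftrightarrow> \<alpha> = \<beta>"
      using comp_inj[of \<alpha> \<pi> \<beta>] * by (auto simp: Gam_def)
    then show "(if \<alpha> \<circ>\<^sub>m \<pi> = \<beta> \<circ>\<^sub>m \<pi> then 1 else (0::'a)) = (if \<alpha> = \<beta> then 1 else 0)" by simp
  qed
  then obtain \<zeta> where \<zeta>: "?P \<zeta>" by blast
  have "?P (schur_one d n)"
    unfolding schur_one_def
  proof (rule theI[of ?P, OF \<zeta>])
    show "\<zeta>' = \<zeta>" if "?P \<zeta>'" for \<zeta>'
      using that \<zeta> by (intro forms_cc_eqI[of _ d n]) auto
  qed
  then show "(schur_one d n :: ('a mat \<Rightarrow> 'a) \<Rightarrow> 'a) \<in> forms d n"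
    and "\<lbrakk>X \<subseteq> {1..n}; \<alpha> \<in> Gam X d; \<beta> \<in> Gam X d\<rbrakk> \<Longrightarrow>
      (schur_one d n :: ('a mat \<Rightarrow> 'a) \<Rightarrow> 'a) (cc d \<alpha> \<beta>) = (if \<alpha> = \<beta> then 1 else 0)"
    by blast+
qed

section \<open>The two actions and their centralizers\<close>

text \<open>For \<open>X\<close> inside \<open>{1..n}\<close> these are the idempotents of the rook
  monoid; \<open>pid Y \<circ>\<^sub>m \<sigma>\<close> is the restriction of
  \<open>\<sigma>\<close> to the places that it sends into \<open>Y\<close>.\<close>

definition pid :: "nat set \<Rightarrow> (nat \<rightharpoonup> nat)" where
  "pid X = (\<lambda>i. if i \<in> X then Some i else None)"

lemma rook_one_eq_pid: "rook_one n = pid {1..n}"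
  by (simp add: rook_one_def pid_def)

lemma dom_pid: "dom (pid X) = X" and ran_pid: "ran (pid X) = X"
  by (auto simp: pid_def ran_def split: if_splits)

lemma pid_rook: "X \<subseteq> {1..n} \<Longrightarrow> pid X \<in> rook n"
  by (simp add: rook_def dom_pid ran_pid) (simp add: inj_on_def pid_def)

lemma comp_pid:
  assumes "dom \<alpha> \<subseteq> X"
  shows "\<alpha> \<circ>\<^sub>m pid X = \<alpha>"
proof
  fix i
  have "\<alpha> i = None" if "i \<notin> X" using assms that by blast
  then show "(\<alpha> \<circ>\<^sub>m pid X) i = \<alpha> i" by (simp add: pid_def map_comp_def)
qed

lemma pid_comp: "ran \<alpha> \<subseteq> X \<Longrightarrow> pid X \<circ>\<^sub>m \<alpha> = \<alpha>"
  by (auto simp: pid_def map_comp_def fun_eq_iff ran_def subset_iff split: option.splits)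

lemma ran_pid_comp:
  assumes "Y \<subseteq> ran \<sigma>"
  shows "ran (pid Y \<circ>\<^sub>m \<sigma>) = Y"
proof
  show "ran (pid Y \<circ>\<^sub>m \<sigma>) \<subseteq> Y" using ran_comp[of "pid Y" \<sigma>] by (simp add: ran_pid)
  show "Y \<subseteq> ran (pid Y \<circ>\<^sub>m \<sigma>)"
  proof
    fix x assume x: "x \<in> Y"
    then obtain i where "\<sigma> i = Some x" using assms by (auto simp: ran_def)
    then have "(pid Y \<circ>\<^sub>m \<sigma>) i = Some x" using x by (simp add: pid_def)
    then show "x \<in> ran (pid Y \<circ>\<^sub>m \<sigma>)" by (rule ranI)
  qed
qed

lemma rook_comp:
  assumes "\<sigma> \<in> rook n" "\<tau> \<in> rook n"
  shows "\<sigma> \<circ>\<^sub>m \<tau> \<in> rook n"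
proof -
  have "i = j" if eq: "(\<sigma> \<circ>\<^sub>m \<tau>) i = Some x" "(\<sigma> \<circ>\<^sub>m \<tau>) j = Some x" for i j x
  proof -
    obtain k l where "\<tau> i = Some k" "\<sigma> k = Some x" "\<tau> j = Some l" "\<sigma> l = Some x"
      using eq by (auto simp: map_comp_def split: option.splits)
    then show ?thesis using rook_inj[OF assms(1)] rook_inj[OF assms(2)] by metis
  qed
  then have "inj_on (\<sigma> \<circ>\<^sub>m \<tau>) (dom (\<sigma> \<circ>\<^sub>m \<tau>))"
    unfolding inj_on_def by (metis domD)
  then show ?thesis
    using assms ran_comp[of \<sigma> \<tau>] by (auto simp: rook_def dom_comp)
qed

section \<open>The operators of the two actions and their matrices\<close>

locale tensor_actions = finite_basis sT "T_index d n" E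
  for sT :: "'a::field_char_0 \<Rightarrow> 't::ab_group_add \<Rightarrow> 't" and d n :: nat
    and E :: "(nat \<rightharpoonup> nat) \<Rightarrow> 't" +
  assumes n_le_d: "n \<le> d"
begin

abbreviation "sact \<equiv> schur_act sT d n E"
abbreviation "ract1 \<equiv> rook_act1 sT d n E"
abbreviation "ract \<equiv> rook_act sT d n E"
abbreviation "S \<equiv> (schur_alg d n :: ('a, ('a mat \<Rightarrow> 'a) \<Rightarrow> 'a) module)"
abbreviation "R \<equiv> (rook_alg n :: ('a, (nat \<rightharpoonup> nat) \<Rightarrow> 'a) module)"

abbreviation lin :: "('t \<Rightarrow> 't) \<Rightarrow> bool" where "lin \<equiv> Vector_Spaces.linear sT sT"

lemma lin_add: "lin f \<Longrightarrow> f (x + y) = f x + f y"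
  by (simp add: Vector_Spaces.linear_iff)

lemma lin_scale: "lin f \<Longrightarrow> f (sT k x) = sT k (f x)"
  by (simp add: Vector_Spaces.linear_iff)

lemma lin_sum: "lin f \<Longrightarrow> f (sum g A) = (\<Sum>x\<in>A. f (g x))"
  using module_hom.sum[of sT sT f g A] by (simp add: Vector_Spaces.linear_iff_module_hom)

lemma lin_0: "lin f \<Longrightarrow> f 0 = 0"
  using lin_sum[of f "\<lambda>x. x" "{}"] by simp

lemma lin_comp: "lin f \<Longrightarrow> lin g \<Longrightarrow> lin (f \<circ> g)"
  by (rule Vector_Spaces.linear_compose)

lemma lin_comb:
  assumes "\<And>i. i \<in> A \<Longrightarrow> lin (f i)"
  shows "lin (\<lambda>t. \<Sum>i\<in>A. sT (c i) (f i t))"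
  unfolding Vector_Spaces.linear_iff
proof (intro conjI allI)
  show "(\<Sum>i\<in>A. sT (c i) (f i (x + y))) = (\<Sum>i\<in>A. sT (c i) (f i x)) + (\<Sum>i\<in>A. sT (c i) (f i y))" for x y
    unfolding sum.distrib[symmetric]
    by (rule sum.cong) (simp_all add: lin_add[OF assms] scale_right_distrib)
  show "(\<Sum>i\<in>A. sT (c i) (f i (sT k x))) = sT k (\<Sum>i\<in>A. sT (c i) (f i x))" for k x
    unfolding scale_sum_right
    by (rule sum.cong) (simp_all add: lin_scale[OF assms] mult.commute)
qed (fact vector_space_axioms)+

lemma Gam_T_index: "\<alpha> \<in> Gam X d \<Longrightarrow> X \<subseteq> {1..n} \<Longrightarrow> \<alpha> \<in> T_index d n"
  by (auto simp: T_index_iff Gam_def)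

lemma T_index_Gam: "\<alpha> \<in> T_index d n \<Longrightarrow> \<alpha> \<in> Gam (dom \<alpha>) d"
  by (auto simp: T_index_iff Gam_def)

lemma T_index_dom: "\<alpha> \<in> T_index d n \<Longrightarrow> dom \<alpha> \<subseteq> {1..n}"
  by (simp add: T_index_iff)

lemma T_index_comp: "\<alpha> \<in> T_index d n \<Longrightarrow> \<sigma> \<in> rook n \<Longrightarrow> \<alpha> \<circ>\<^sub>m \<sigma> \<in> T_index d n"
  using ran_comp[of \<alpha> \<sigma>] rookD(1)[of \<sigma> n] by (auto simp: T_index_iff dom_comp)

text \<open>Here \<open>n_le_d\<close> enters: the values of a rook element are at most
  \<open>n\<close>, so it can itself serve as an index of the basis.\<close>

lemma rook_T_index: "\<sigma> \<in> rook n \<Longrightarrow> \<sigma> \<in> T_index d n"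
  using n_le_d by (auto simp: T_index_iff rook_def)

lemma pid_Gam: "X \<subseteq> {1..n} \<Longrightarrow> pid X \<in> Gam X d"
  using n_le_d by (auto simp: Gam_def dom_pid ran_pid)

lemma linear_sact: "lin (sact \<xi>)"
  unfolding schur_act_def by (rule linear_lin_ext)

lemma linear_ract1: "lin (ract1 \<sigma>)"
  unfolding rook_act1_def by (rule linear_lin_ext)

lemma linear_ract: "lin (ract a)"
  unfolding rook_act_def[abs_def] by (rule lin_comb) (rule linear_ract1)

lemma sact_E:
  "\<beta> \<in> T_index d n \<Longrightarrow> sact \<xi> (E \<beta>) = (\<Sum>\<alpha>\<in>Gam (dom \<beta>) d. sT (\<xi> (cc d \<alpha> \<beta>)) (E \<alpha>))"
  unfolding schur_act_def by (rule lin_ext_basis)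

lemma ract1_E:
  "\<alpha> \<in> T_index d n \<Longrightarrow> ract1 \<sigma> (E \<alpha>) = (if dom \<alpha> \<subseteq> ran \<sigma> then E (\<alpha> \<circ>\<^sub>m \<sigma>) else 0)"
  unfolding rook_act1_def by (rule lin_ext_basis)

lemma coord_sact:
  assumes "\<alpha> \<in> T_index d n" "\<beta> \<in> T_index d n"
  shows "coord (sact \<xi> (E \<beta>)) \<alpha> = (if dom \<alpha> = dom \<beta> then \<xi> (cc d \<alpha> \<beta>) else 0)"
proof -
  have "Gam (dom \<beta>) d \<subseteq> T_index d n"
    using Gam_T_index T_index_dom[OF assms(2)] by blast
  moreover have "\<alpha> \<in> Gam (dom \<beta>) d \<longleftrightarrow> dom \<alpha> = dom \<beta>"
    using assms(1) by (auto simp: T_index_iff Gam_def)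
  ultimately show ?thesis
    unfolding sact_E[OF assms(2)] by (simp add: coord_comb[OF assms(1)])
qed

lemma sact_eqI:
  assumes "lin f"
    and "\<And>\<alpha> \<beta>. \<alpha> \<in> T_index d n \<Longrightarrow> \<beta> \<in> T_index d n \<Longrightarrow>
      coord (f (E \<beta>)) \<alpha> = (if dom \<alpha> = dom \<beta> then \<xi> (cc d \<alpha> \<beta>) else 0)"
  shows "f = sact \<xi>"
  by (rule linear_eqI[OF assms(1) linear_sact], rule coord_eqI) (simp add: assms(2) coord_sact)

section \<open>The right module structure and the commutation of the two actions\<close>

lemma ract1_comp:
  assumes "\<sigma> \<in> rook n" "\<tau> \<in> rook n"
  shows "ract1 (\<sigma> \<circ>\<^sub>m \<tau>) = ract1 \<tau> \<circ> ract1 \<sigma>"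
proof (rule linear_eqI[OF linear_ract1 lin_comp[OF linear_ract1 linear_ract1]])
  fix \<alpha> assume \<alpha>: "\<alpha> \<in> T_index d n"
  \<comment> \<open>Both sides are nonzero on \<open>E \<alpha>\<close> under the same condition:
    \<open>\<sigma>\<close> reaches every point of \<open>dom \<alpha>\<close> from exactly one
    place, and \<open>\<tau>\<close> has to reach that place.\<close>
  have iff: "dom \<alpha> \<subseteq> ran (\<sigma> \<circ>\<^sub>m \<tau>) \<longleftrightarrow> dom \<alpha> \<subseteq> ran \<sigma> \<and> dom (\<alpha> \<circ>\<^sub>m \<sigma>) \<subseteq> ran \<tau>"
  proof
    assume *: "dom \<alpha> \<subseteq> ran (\<sigma> \<circ>\<^sub>m \<tau>)"
    have "i \<in> ran \<tau>" if i: "\<sigma> i = Some x" "x \<in> dom \<alpha>" for i x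
    proof -
      obtain j where "(\<sigma> \<circ>\<^sub>m \<tau>) j = Some x" using * i(2) by (auto simp: ran_def)
      then obtain k where "\<tau> j = Some k" "\<sigma> k = Some x"
        by (auto simp: map_comp_def split: option.splits)
      then show ?thesis using rook_inj[OF assms(1) i(1)] by (auto simp: ran_def)
    qed
    then show "dom \<alpha> \<subseteq> ran \<sigma> \<and> dom (\<alpha> \<circ>\<^sub>m \<sigma>) \<subseteq> ran \<tau>"
      using * ran_comp[of \<sigma> \<tau>] by (auto simp: dom_comp)
  next
    assume *: "dom \<alpha> \<subseteq> ran \<sigma> \<and> dom (\<alpha> \<circ>\<^sub>m \<sigma>) \<subseteq> ran \<tau>"
    show "dom \<alpha> \<subseteq> ran (\<sigma> \<circ>\<^sub>m \<tau>)"
    proof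
      fix x assume x: "x \<in> dom \<alpha>"
      then obtain i where i: "\<sigma> i = Some x" using * by (auto simp: ran_def)
      then have "i \<in> ran \<tau>" using * x by (auto simp: dom_comp)
      then obtain j where "\<tau> j = Some i" by (auto simp: ran_def)
      then have "(\<sigma> \<circ>\<^sub>m \<tau>) j = Some x" using i by simp
      then show "x \<in> ran (\<sigma> \<circ>\<^sub>m \<tau>)" by (rule ranI)
    qed
  qed
  show "ract1 (\<sigma> \<circ>\<^sub>m \<tau>) (E \<alpha>) = (ract1 \<tau> \<circ> ract1 \<sigma>) (E \<alpha>)"
    using iff by (simp add: ract1_E \<alpha> T_index_comp assms lin_0[OF linear_ract1] map_comp_assoc)
qed

lemma ract1_one: "ract1 (rook_one n) = id"
proof (rule linear_eqI[OF linear_ract1])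
  show "lin id" by (simp add: Vector_Spaces.linear_iff vector_space_axioms)
  fix \<alpha> assume \<alpha>: "\<alpha> \<in> T_index d n"
  show "ract1 (rook_one n) (E \<alpha>) = id (E \<alpha>)"
    using T_index_dom[OF \<alpha>] by (simp add: rook_one_eq_pid ract1_E \<alpha> ran_pid comp_pid)
qed

lemma ract_add: "ract (a \<oplus>\<^bsub>R\<^esub> b) t = ract a t + ract b t"
  by (simp add: rook_act_def rook_alg_def scale_left_distrib sum.distrib)

lemma ract_smult: "ract (k \<odot>\<^bsub>R\<^esub> a) t = sT k (ract a t)"
  by (simp add: rook_act_def rook_alg_def scale_sum_right)

lemma ract_single:
  assumes "\<sigma> \<in> rook n"
  shows "ract (\<lambda>\<tau>. if \<tau> = \<sigma> then 1 else 0) t = ract1 \<sigma> t"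
proof -
  have "ract (\<lambda>\<tau>. if \<tau> = \<sigma> then 1 else 0) t = (\<Sum>\<tau>\<in>rook n. if \<tau> = \<sigma> then ract1 \<sigma> t else 0)"
    unfolding rook_act_def by (rule sum.cong) auto
  then show ?thesis using assms finite_rook by simp
qed

lemma ract_one: "ract \<one>\<^bsub>R\<^esub> t = t"
  using ract_single[OF pid_rook[OF order_refl], of t]
  unfolding rook_one_eq_pid[symmetric] by (simp add: rook_alg_def ract1_one)

text \<open>Sorting the pairs \<open>(\<sigma>, \<tau>)\<close> by their product unfolds the
  convolution into a double sum, and \<open>ract1_comp\<close> reverses the order.\<close>

lemma ract_mult: "ract (a \<otimes>\<^bsub>R\<^esub> b) t = ract b (ract a t)"
proof -
  let ?Z = "rook n \<times> rook n"
  let ?f = "\<lambda>(\<sigma>, \<tau>). sT (a \<sigma> * b \<tau>) (ract1 (\<sigma> \<circ>\<^sub>m \<tau>) t)"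
  have Z: "{(\<sigma>, \<tau>). \<sigma> \<in> rook n \<and> \<tau> \<in> rook n \<and> \<sigma> \<circ>\<^sub>m \<tau> = \<rho>} = {z \<in> ?Z. (case z of (\<sigma>, \<tau>) \<Rightarrow> \<sigma> \<circ>\<^sub>m \<tau>) = \<rho>}" for \<rho>
    by auto
  have "ract (a \<otimes>\<^bsub>R\<^esub> b) t =
      (\<Sum>\<rho>\<in>rook n. \<Sum>z\<in>{z \<in> ?Z. (case z of (\<sigma>, \<tau>) \<Rightarrow> \<sigma> \<circ>\<^sub>m \<tau>) = \<rho>}. ?f z)"
    unfolding rook_act_def
  proof (rule sum.cong)
    fix \<rho>
    have "(a \<otimes>\<^bsub>R\<^esub> b) \<rho> = (\<Sum>(\<sigma>, \<tau>)\<in>{z \<in> ?Z. (case z of (\<sigma>, \<tau>) \<Rightarrow> \<sigma> \<circ>\<^sub>m \<tau>) = \<rho>}. a \<sigma> * b \<tau>)"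
      by (simp add: rook_alg_def Z)
    then show "sT ((a \<otimes>\<^bsub>R\<^esub> b) \<rho>) (ract1 \<rho> t) =
        (\<Sum>z\<in>{z \<in> ?Z. (case z of (\<sigma>, \<tau>) \<Rightarrow> \<sigma> \<circ>\<^sub>m \<tau>) = \<rho>}. ?f z)"
      by (auto simp only: scale_sum_left intro!: sum.cong)
  qed simp
  also have "\<dots> = (\<Sum>z\<in>?Z. ?f z)"
    by (rule sum.group) (auto simp: finite_rook rook_comp)
  also have "\<dots> = (\<Sum>\<sigma>\<in>rook n. \<Sum>\<tau>\<in>rook n. sT (a \<sigma> * b \<tau>) (ract1 \<tau> (ract1 \<sigma> t)))"
    unfolding sum.cartesian_product[symmetric]
    by (intro sum.cong refl) (simp add: ract1_comp)
  also have "\<dots> = (\<Sum>\<tau>\<in>rook n. \<Sum>\<sigma>\<in>rook n. sT (a \<sigma> * b \<tau>) (ract1 \<tau> (ract1 \<sigma> t)))"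
    by (rule sum.swap)
  also have "\<dots> = ract b (ract a t)"
    unfolding rook_act_def
    by (intro sum.cong refl)
      (simp add: lin_sum[OF linear_ract1] lin_scale[OF linear_ract1] scale_sum_right mult.commute)
  finally show ?thesis .
qed

lemma right_module_ract: "right_module_over R sT ract"
  unfolding right_module_over_def
  using linear_ract ract_add ract_smult ract_one ract_mult by blast

text \<open>If \<open>\<sigma>\<close> covers \<open>dom \<beta>\<close>, composition with
  \<open>\<sigma>\<close> reindexes the sum and keeps its monomials. Otherwise both sides vanish,
  since all indices in the sum have the domain of \<open>\<beta>\<close>.\<close>

lemma sact_ract1:
  assumes "\<sigma> \<in> rook n"
  shows "sact \<xi> \<circ> ract1 \<sigma> = ract1 \<sigma> \<circ> sact \<xi>"
proof (rule linear_eqI[OF lin_comp[OF linear_sact linear_ract1] lin_comp[OF linear_ract1 linear_sact]])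
  fix \<beta> assume \<beta>: "\<beta> \<in> T_index d n"
  let ?X = "dom \<beta>"
  have G: "\<beta> \<in> Gam ?X d" by (rule T_index_Gam[OF \<beta>])
  have I: "\<alpha> \<in> T_index d n" "dom \<alpha> = ?X" if "\<alpha> \<in> Gam ?X d" for \<alpha>
    using Gam_T_index[OF that T_index_dom[OF \<beta>]] that by (auto simp: Gam_def)
  have R: "ract1 \<sigma> (sact \<xi> (E \<beta>)) = (\<Sum>\<alpha>\<in>Gam ?X d. sT (\<xi> (cc d \<alpha> \<beta>)) (ract1 \<sigma> (E \<alpha>)))"
    by (simp add: sact_E[OF \<beta>] lin_sum[OF linear_ract1] lin_scale[OF linear_ract1])
  show "(sact \<xi> \<circ> ract1 \<sigma>) (E \<beta>) = (ract1 \<sigma> \<circ> sact \<xi>) (E \<beta>)"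
  proof (cases "?X \<subseteq> ran \<sigma>")
    case True
    have "sact \<xi> (ract1 \<sigma> (E \<beta>)) =
        (\<Sum>\<alpha>\<in>Gam (dom (\<beta> \<circ>\<^sub>m \<sigma>)) d. sT (\<xi> (cc d \<alpha> (\<beta> \<circ>\<^sub>m \<sigma>))) (E \<alpha>))"
      using True by (simp add: ract1_E[OF \<beta>] sact_E[OF T_index_comp[OF \<beta> assms]])
    also have "\<dots> = (\<Sum>\<alpha>\<in>Gam ?X d. sT (\<xi> (cc d (\<alpha> \<circ>\<^sub>m \<sigma>) (\<beta> \<circ>\<^sub>m \<sigma>))) (E (\<alpha> \<circ>\<^sub>m \<sigma>)))"
      by (rule sum.reindex_bij_betw[symmetric, OF bij_betw_Gam_comp[OF assms G True]])
    also have "\<dots> = (\<Sum>\<alpha>\<in>Gam ?X d. sT (\<xi> (cc d \<alpha> \<beta>)) (ract1 \<sigma> (E \<alpha>)))"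
      by (rule sum.cong) (use True in \<open>simp_all add: cc_comp[OF assms _ G True] ract1_E I\<close>)
    finally show ?thesis by (simp add: R)
  next
    case False
    then have "ract1 \<sigma> (E \<alpha>) = 0" if "\<alpha> \<in> Gam ?X d" for \<alpha>
      using I[OF that] by (simp add: ract1_E)
    then show ?thesis
      using G by (simp add: R lin_0[OF linear_sact])
  qed
qed

lemma sact_ract: "sact \<xi> \<circ> ract a = ract a \<circ> sact \<xi>"
proof
  fix t
  have "sact \<xi> (ract1 \<sigma> t) = ract1 \<sigma> (sact \<xi> t)" if "\<sigma> \<in> rook n" for \<sigma>
    using fun_cong[OF sact_ract1[OF that], of \<xi> t] by simp
  then show "(sact \<xi> \<circ> ract a) t = (ract a \<circ> sact \<xi>) t"
    by (simp add: rook_act_def lin_sum[OF linear_sact] lin_scale[OF linear_sact])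
qed

section \<open>The centralizer of the rook action\<close>

lemma coord_ract1:
  assumes "\<sigma> \<in> rook n" "\<alpha> \<in> T_index d n" "dom \<alpha> \<subseteq> ran \<sigma>"
  shows "coord (ract1 \<sigma> t) (\<alpha> \<circ>\<^sub>m \<sigma>) = coord t \<alpha>"
proof -
  \<comment> \<open>No index other than \<open>\<alpha>\<close> contributes, because composition
    with \<open>\<sigma>\<close> is injective on indices whose domain it covers.\<close>
  have "coord (ract1 \<sigma> (E \<gamma>)) (\<alpha> \<circ>\<^sub>m \<sigma>) = (if \<gamma> = \<alpha> then 1 else 0)" if "\<gamma> \<in> T_index d n" for \<gamma>
  proof (cases "dom \<gamma> \<subseteq> ran \<sigma>")
    case True
    then have "\<alpha> \<circ>\<^sub>m \<sigma> = \<gamma> \<circ>\<^sub>m \<sigma> \<longleftrightarrow> \<gamma> = \<alpha>"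
      using comp_inj[of \<alpha> \<sigma> \<gamma>] assms(3) by auto
    with True that assms show ?thesis
      by (simp add: ract1_E coord_basis T_index_comp)
  next
    case False
    \<comment> \<open>The zero vector is written as a scalar multiple so that
      \<open>coord_scale\<close> evaluates its coordinate.\<close>
    then have "ract1 \<sigma> (E \<gamma>) = sT 0 0" "\<gamma> \<noteq> \<alpha>" using that assms(3) by (auto simp: ract1_E)
    then show ?thesis by (simp only: coord_scale) simp
  qed
  then have "coord (ract1 \<sigma> t) (\<alpha> \<circ>\<^sub>m \<sigma>) = (\<Sum>\<gamma>\<in>T_index d n. if \<gamma> = \<alpha> then coord t \<gamma> else 0)"
    unfolding linear_expand[OF linear_ract1, of \<sigma> t] coord_sum coord_scale
    by (intro sum.cong) auto
  then show ?thesis using assms(2) finite_I by simp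
qed

lemma coord_0: "coord 0 \<alpha> = 0"
  using coord_scale[of 0 0 \<alpha>] by simp

text \<open>Commuting with the partial identities forces \<open>f\<close> to preserve the domain of the index;
  commuting with the other \<open>\<sigma>\<close> makes the matrix of \<open>f\<close> constant on the pairs of indices that give
  the same monomial.\<close>

lemma centralizer_ract_sact:
  assumes "lin f" and comm: "\<And>\<sigma>. \<sigma> \<in> rook n \<Longrightarrow> f \<circ> ract1 \<sigma> = ract1 \<sigma> \<circ> f"
  shows "\<exists>\<xi>\<in>forms d n. f = sact \<xi>"
proof -
  let ?M = "\<lambda>\<alpha> \<beta>. coord (f (E \<beta>)) \<alpha>"
  have comm': "f (ract1 \<sigma> t) = ract1 \<sigma> (f t)" if "\<sigma> \<in> rook n" for \<sigma> t
    using fun_cong[OF comm[OF that], of t] by simp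
  have block: "?M \<alpha> \<beta> = 0" if \<alpha>: "\<alpha> \<in> T_index d n" and \<beta>: "\<beta> \<in> T_index d n" and ne: "dom \<alpha> \<noteq> dom \<beta>" for \<alpha> \<beta>
  proof (cases "dom \<alpha> \<subseteq> dom \<beta>")
    case True
    have r: "pid (dom \<alpha>) \<in> rook n" by (rule pid_rook[OF T_index_dom[OF \<alpha>]])
    \<comment> \<open>As \<open>dom \<alpha>\<close> is properly inside \<open>dom \<beta>\<close>,
      its partial identity kills \<open>E \<beta>\<close> but keeps the coordinate at
      \<open>\<alpha>\<close>.\<close>
    have "ract1 (pid (dom \<alpha>)) (E \<beta>) = 0"
      using True ne by (auto simp: ract1_E[OF \<beta>] ran_pid)
    then have "ract1 (pid (dom \<alpha>)) (f (E \<beta>)) = 0"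
      using comm'[OF r, of "E \<beta>"] lin_0[OF assms(1)] by simp
    then show ?thesis
      using coord_ract1[OF r \<alpha>, of "f (E \<beta>)"] by (simp add: ran_pid comp_pid coord_0)
  next
    case False
    let ?\<pi> = "pid (dom \<beta>)"
    have r: "?\<pi> \<in> rook n" by (rule pid_rook[OF T_index_dom[OF \<beta>]])
    \<comment> \<open>Here the partial identity of \<open>dom \<beta>\<close> fixes
      \<open>E \<beta>\<close>, while its image has no component at \<open>\<alpha>\<close>.\<close>
    have "coord (ract1 ?\<pi> (E \<gamma>)) \<alpha> = 0" if "\<gamma> \<in> T_index d n" for \<gamma>
      using that \<alpha> False by (auto simp: ract1_E ran_pid comp_pid coord_basis coord_0)
    then have "coord (ract1 ?\<pi> (f (E \<beta>))) \<alpha> = 0"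
      unfolding linear_expand[OF linear_ract1, of ?\<pi> "f (E \<beta>)"] coord_sum coord_scale
      by (intro sum.neutral) auto
    moreover have "ract1 ?\<pi> (E \<beta>) = E \<beta>"
      by (simp add: ract1_E[OF \<beta>] ran_pid comp_pid)
    ultimately show ?thesis using comm'[OF r, of "E \<beta>"] by simp
  qed
  have "\<exists>\<xi>\<in>forms d n. \<forall>X\<subseteq>{1..n}. \<forall>\<alpha>\<in>Gam X d. \<forall>\<beta>\<in>Gam X d. \<xi> (cc d \<alpha> \<beta>) = ?M \<alpha> \<beta>"
  proof (rule forms_of_invariant)
    fix X \<alpha> \<beta> \<pi>
    assume *: "X \<subseteq> {1..n}" "\<alpha> \<in> Gam X d" "\<beta> \<in> Gam X d" "\<pi> \<in> rook n" "ran \<pi> = X"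
    have I: "\<alpha> \<in> T_index d n" "\<beta> \<in> T_index d n" and dom: "dom \<alpha> = X" "dom \<beta> = X"
      using * Gam_T_index by (auto simp: Gam_def)
    have "f (E (\<beta> \<circ>\<^sub>m \<pi>)) = ract1 \<pi> (f (E \<beta>))"
      using comm'[OF *(4), of "E \<beta>"] dom *(5) by (simp add: ract1_E[OF I(2)])
    then show "?M (\<alpha> \<circ>\<^sub>m \<pi>) (\<beta> \<circ>\<^sub>m \<pi>) = ?M \<alpha> \<beta>"
      using coord_ract1[OF *(4) I(1)] dom *(5) by simp
  qed
  then obtain \<xi> where \<xi>: "\<xi> \<in> forms d n"
      "\<forall>X\<subseteq>{1..n}. \<forall>\<alpha>\<in>Gam X d. \<forall>\<beta>\<in>Gam X d. \<xi> (cc d \<alpha> \<beta>) = ?M \<alpha> \<beta>"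
    by blast
  have "f = sact \<xi>"
  proof (rule sact_eqI[OF assms(1)])
    fix \<alpha> \<beta> assume \<alpha>: "\<alpha> \<in> T_index d n" and \<beta>: "\<beta> \<in> T_index d n"
    show "?M \<alpha> \<beta> = (if dom \<alpha> = dom \<beta> then \<xi> (cc d \<alpha> \<beta>) else 0)"
    proof (cases "dom \<alpha> = dom \<beta>")
      case True
      then show ?thesis
        using \<xi>(2) T_index_dom[OF \<beta>] T_index_Gam[OF \<beta>] T_index_Gam[OF \<alpha>] by simp
    qed (simp add: block[OF \<alpha> \<beta>])
  qed
  with \<xi>(1) show ?thesis by blast
qed

section \<open>The centralizer of the action of the forms\<close>

definition gact :: "(nat \<rightharpoonup> nat) \<Rightarrow> 't \<Rightarrow> 't" where
  "gact \<sigma> = lin_ext sT (T_index d n) E (\<lambda>\<alpha>. if dom \<alpha> = ran \<sigma> then E (\<alpha> \<circ>\<^sub>m \<sigma>) else 0)"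

lemma linear_gact: "lin (gact \<sigma>)"
  unfolding gact_def by (rule linear_lin_ext)

lemma gact_E:
  "\<alpha> \<in> T_index d n \<Longrightarrow> gact \<sigma> (E \<alpha>) = (if dom \<alpha> = ran \<sigma> then E (\<alpha> \<circ>\<^sub>m \<sigma>) else 0)"
  unfolding gact_def by (rule lin_ext_basis)

text \<open>On \<open>E \<alpha>\<close> only the restriction of \<open>\<sigma>\<close> with range
  \<open>dom \<alpha>\<close> contributes, and there it agrees with \<open>\<sigma>\<close>. The
  \<open>gact\<close> are the operators of the groupoid basis of the rook algebra, related to the
  \<open>ract1\<close> by Moebius inversion over restrictions.\<close>

lemma ract1_eq_sum_gact:
  assumes "\<sigma> \<in> rook n"
  shows "ract1 \<sigma> t = (\<Sum>Y\<in>Pow (ran \<sigma>). gact (pid Y \<circ>\<^sub>m \<sigma>) t)"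
proof -
  have "ract1 \<sigma> = (\<lambda>t. \<Sum>Y\<in>Pow (ran \<sigma>). sT 1 (gact (pid Y \<circ>\<^sub>m \<sigma>) t))"
  proof (rule linear_eqI[OF linear_ract1 lin_comb[OF linear_gact]])
    fix \<alpha> assume \<alpha>: "\<alpha> \<in> T_index d n"
    have fin: "finite (Pow (ran \<sigma>))"
      using rookD(2)[OF assms] by (meson finite_Pow_iff finite_atLeastAtMost finite_subset)
    have "(\<Sum>Y\<in>Pow (ran \<sigma>). sT 1 (gact (pid Y \<circ>\<^sub>m \<sigma>) (E \<alpha>))) =
        (\<Sum>Y\<in>Pow (ran \<sigma>). if Y = dom \<alpha> then E (\<alpha> \<circ>\<^sub>m \<sigma>) else 0)"
    proof (rule sum.cong)
      fix Y assume "Y \<in> Pow (ran \<sigma>)"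
      then have "ran (pid Y \<circ>\<^sub>m \<sigma>) = Y" by (simp add: ran_pid_comp)
      moreover have "\<alpha> \<circ>\<^sub>m (pid (dom \<alpha>) \<circ>\<^sub>m \<sigma>) = \<alpha> \<circ>\<^sub>m \<sigma>"
        unfolding map_comp_assoc[symmetric] by (simp add: comp_pid)
      ultimately show "sT 1 (gact (pid Y \<circ>\<^sub>m \<sigma>) (E \<alpha>)) = (if Y = dom \<alpha> then E (\<alpha> \<circ>\<^sub>m \<sigma>) else 0)"
        by (auto simp: gact_E[OF \<alpha>])
    qed simp
    also have "\<dots> = ract1 \<sigma> (E \<alpha>)"
      using fin by (simp add: ract1_E[OF \<alpha>])
    finally show "ract1 \<sigma> (E \<alpha>) = (\<Sum>Y\<in>Pow (ran \<sigma>). sT 1 (gact (pid Y \<circ>\<^sub>m \<sigma>) (E \<alpha>)))" by simp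
  qed
  then show ?thesis by simp
qed

lemma carrier_R: "a \<in> carrier R \<longleftrightarrow> (\<forall>\<sigma>. \<sigma> \<notin> rook n \<longrightarrow> a \<sigma> = 0)"
  by (simp add: rook_alg_def)

lemma ract_image_comb:
  assumes "\<And>i. i \<in> A \<Longrightarrow> f i \<in> ract ` carrier R"
  shows "(\<lambda>t. \<Sum>i\<in>A. sT (c i) (f i t)) \<in> ract ` carrier R"
proof -
  from assms obtain a where a: "\<And>i. i \<in> A \<Longrightarrow> a i \<in> carrier R \<and> f i = ract (a i)"
    unfolding image_iff by metis
  define b where "b \<sigma> = (\<Sum>i\<in>A. c i * a i \<sigma>)" for \<sigma>
  have "b \<in> carrier R"
    using a by (auto simp: carrier_R b_def intro!: sum.neutral)
  moreover have "(\<lambda>t. \<Sum>i\<in>A. sT (c i) (f i t)) = ract b"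
  proof
    fix t
    have "(\<Sum>i\<in>A. sT (c i) (f i t)) = (\<Sum>i\<in>A. \<Sum>\<sigma>\<in>rook n. sT (c i * a i \<sigma>) (ract1 \<sigma> t))"
      by (intro sum.cong refl) (simp add: a rook_act_def scale_sum_right)
    also have "\<dots> = (\<Sum>\<sigma>\<in>rook n. \<Sum>i\<in>A. sT (c i * a i \<sigma>) (ract1 \<sigma> t))"
      by (rule sum.swap)
    also have "\<dots> = ract b t"
      by (simp add: rook_act_def b_def scale_sum_left)
    finally show "(\<Sum>i\<in>A. sT (c i) (f i t)) = ract b t" .
  qed
  ultimately show ?thesis by blast
qed

lemma ract1_image: "\<sigma> \<in> rook n \<Longrightarrow> ract1 \<sigma> \<in> ract ` carrier R"
  using ract_single[of \<sigma>]
  by (intro image_eqI[of _ _ "\<lambda>\<tau>. if \<tau> = \<sigma> then 1 else 0"]) (auto simp: carrier_R)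

text \<open>The triangular relation is solved for \<open>gact \<sigma>\<close>; the proper
  restrictions of \<open>\<sigma>\<close> have smaller range, so induction covers them.\<close>

lemma gact_image:
  assumes "\<sigma> \<in> rook n"
  shows "gact \<sigma> \<in> ract ` carrier R"
  using assms
proof (induction "card (ran \<sigma>)" arbitrary: \<sigma> rule: less_induct)
  case less
  let ?P = "Pow (ran \<sigma>)"
  have fin: "finite (ran \<sigma>)"
    using rookD(2)[OF less.prems] by (meson finite_atLeastAtMost finite_subset)
  \<comment> \<open>The difference of \<open>ract1 \<sigma>\<close> and all \<open>gact\<close> of
    proper restrictions becomes one combination over the subsets of \<open>ran \<sigma>\<close>,
    with \<open>ract1 \<sigma>\<close> put at the full range.\<close>
  define g where "g Y = (if Y = ran \<sigma> then ract1 \<sigma> else gact (pid Y \<circ>\<^sub>m \<sigma>))" for Y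
  define c where "c Y = (if Y = ran \<sigma> then 1 else - 1 :: 'a)" for Y
  have "g Y \<in> ract ` carrier R" if "Y \<in> ?P" for Y
  proof (cases "Y = ran \<sigma>")
    case False
    have "Y \<subseteq> {1..n}" using that rookD(2)[OF less.prems] by blast
    then have "gact (pid Y \<circ>\<^sub>m \<sigma>) \<in> ract ` carrier R"
    proof (intro less.hyps rook_comp pid_rook less.prems)
      show "card (ran (pid Y \<circ>\<^sub>m \<sigma>)) < card (ran \<sigma>)"
        using that False fin by (auto simp: ran_pid_comp intro: psubset_card_mono)
    qed
    then show ?thesis using False by (simp add: g_def)
  qed (simp add: g_def ract1_image[OF less.prems])
  then have "(\<lambda>t. \<Sum>Y\<in>?P. sT (c Y) (g Y t)) \<in> ract ` carrier R"
    by (rule ract_image_comb)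
  moreover have "gact \<sigma> t = (\<Sum>Y\<in>?P. sT (c Y) (g Y t))" for t
  proof -
    have "(\<Sum>Y\<in>?P. sT (c Y) (g Y t)) = ract1 \<sigma> t - (\<Sum>Y\<in>?P - {ran \<sigma>}. gact (pid Y \<circ>\<^sub>m \<sigma>) t)"
      using fin by (subst sum.remove[of _ "ran \<sigma>"])
        (auto simp: c_def g_def sum_negf[symmetric] intro!: sum.cong)
    moreover have "ract1 \<sigma> t = gact \<sigma> t + (\<Sum>Y\<in>?P - {ran \<sigma>}. gact (pid Y \<circ>\<^sub>m \<sigma>) t)"
      unfolding ract1_eq_sum_gact[OF less.prems] using fin
      by (subst sum.remove[of _ "ran \<sigma>"]) (auto simp: pid_comp)
    ultimately show ?thesis by simp
  qed
  ultimately show ?case by (metis (no_types, lifting) ext)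
qed

text \<open>Relabelling \<open>(\<beta>, pid X)\<close> by \<open>\<pi>\<close> gives
  \<open>(\<beta> \<circ>\<^sub>m \<pi>, \<pi>)\<close>, so the second index of a pair in this class
  is itself the relabelling.\<close>

lemma mexp_pid_iff:
  assumes "\<alpha> \<in> Gam Y d" "\<gamma> \<in> Gam Y d" "\<beta> \<in> Gam X d" "X \<subseteq> {1..n}" "Y \<subseteq> {1..n}"
  shows "mexp \<alpha> \<gamma> = mexp \<beta> (pid X) \<longleftrightarrow> \<gamma> \<in> rook n \<and> ran \<gamma> = X \<and> \<alpha> = \<beta> \<circ>\<^sub>m \<gamma>"
proof
  assume "mexp \<alpha> \<gamma> = mexp \<beta> (pid X)"
  then obtain \<pi> where "\<pi> \<in> rook n" "ran \<pi> = X" "\<alpha> = \<beta> \<circ>\<^sub>m \<pi>" "\<gamma> = pid X \<circ>\<^sub>m \<pi>"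
    using mexp_eqD[OF assms(3) pid_Gam[OF assms(4)] assms(1,2,4,5)] by blast
  then show "\<gamma> \<in> rook n \<and> ran \<gamma> = X \<and> \<alpha> = \<beta> \<circ>\<^sub>m \<gamma>" by (simp add: pid_comp)
next
  assume *: "\<gamma> \<in> rook n \<and> ran \<gamma> = X \<and> \<alpha> = \<beta> \<circ>\<^sub>m \<gamma>"
  then show "mexp \<alpha> \<gamma> = mexp \<beta> (pid X)"
    using mexp_comp[OF conjunct1[OF *] assms(3) pid_Gam[OF assms(4)]] by (simp add: pid_comp)
qed

text \<open>The form is the indicator of the monomial of
  \<open>(\<beta>, pid (dom \<beta>))\<close>; by \<open>mexp_pid_iff\<close> only
  \<open>\<alpha> = \<beta> \<circ>\<^sub>m \<gamma>\<close> can pair with a given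
  \<open>\<gamma>\<close>.\<close>

lemma matrix_unit_form:
  assumes \<beta>: "\<beta> \<in> T_index d n"
  shows "\<exists>\<xi>\<in>forms d n. \<forall>\<gamma>\<in>T_index d n.
    sact \<xi> (E \<gamma>) = (if \<gamma> \<in> rook n \<and> ran \<gamma> = dom \<beta> then E (\<beta> \<circ>\<^sub>m \<gamma>) else 0)"
proof -
  let ?X = "dom \<beta>"
  obtain \<xi> where \<xi>: "\<xi> \<in> forms d n"
      "\<And>m. m \<in> expset d n \<Longrightarrow> \<xi> (gl_monomial d m) = (if m = mexp \<beta> (pid ?X) then 1 else (0::'a))"
    using forms_exists[of d n "\<lambda>m. if m = mexp \<beta> (pid ?X) then 1 else 0"] by blast
  have "sact \<xi> (E \<gamma>) = (if \<gamma> \<in> rook n \<and> ran \<gamma> = ?X then E (\<beta> \<circ>\<^sub>m \<gamma>) else 0)"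
    if \<gamma>: "\<gamma> \<in> T_index d n" for \<gamma>
  proof -
    have fin: "finite (dom \<gamma>)" using T_index_dom[OF \<gamma>] finite_subset by blast
    let ?c = "\<gamma> \<in> rook n \<and> ran \<gamma> = ?X"
    have "sact \<xi> (E \<gamma>) = (\<Sum>\<alpha>\<in>Gam (dom \<gamma>) d. if \<alpha> = \<beta> \<circ>\<^sub>m \<gamma> then (if ?c then E (\<beta> \<circ>\<^sub>m \<gamma>) else 0) else 0)"
      unfolding sact_E[OF \<gamma>]
    proof (rule sum.cong)
      fix \<alpha> assume \<alpha>: "\<alpha> \<in> Gam (dom \<gamma>) d"
      have "\<xi> (cc d \<alpha> \<gamma>) = (if mexp \<alpha> \<gamma> = mexp \<beta> (pid ?X) then 1 else 0)"
        using \<xi>(2)[OF mexp_in_expset[OF \<alpha> T_index_Gam[OF \<gamma>] T_index_dom[OF \<gamma>]]]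
        by (simp add: cc_eq_gl_monomial[OF \<alpha> T_index_Gam[OF \<gamma>] fin])
      then show "sT (\<xi> (cc d \<alpha> \<gamma>)) (E \<alpha>) =
          (if \<alpha> = \<beta> \<circ>\<^sub>m \<gamma> then (if ?c then E (\<beta> \<circ>\<^sub>m \<gamma>) else 0) else 0)"
        using mexp_pid_iff[OF \<alpha> T_index_Gam[OF \<gamma>] T_index_Gam[OF \<beta>] T_index_dom[OF \<beta>] T_index_dom[OF \<gamma>]]
        by auto
    qed simp
    also have "\<dots> = (if \<beta> \<circ>\<^sub>m \<gamma> \<in> Gam (dom \<gamma>) d then (if ?c then E (\<beta> \<circ>\<^sub>m \<gamma>) else 0) else 0)"
      using finite_Gam[OF fin] by (rule sum.delta)
    also have "\<dots> = (if ?c then E (\<beta> \<circ>\<^sub>m \<gamma>) else 0)"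
    proof -
      have "\<beta> \<circ>\<^sub>m \<gamma> \<in> Gam (dom \<gamma>) d" if "ran \<gamma> = ?X"
      proof -
        have "dom (\<beta> \<circ>\<^sub>m \<gamma>) = dom \<gamma>"
          unfolding dom_comp that[symmetric] by (auto intro: ranI)
        then show ?thesis using Gam_comp[OF T_index_Gam[OF \<beta>] T_index_Gam[OF \<beta>], of \<gamma>] by simp
      qed
      then show ?thesis by auto
    qed
    finally show ?thesis .
  qed
  with \<xi>(1) show ?thesis by blast
qed

lemma centralizer_sact_ract:
  assumes "lin f" and comm: "\<And>\<xi>. \<xi> \<in> forms d n \<Longrightarrow> f \<circ> sact \<xi> = sact \<xi> \<circ> f"
  shows "f \<in> ract ` carrier R"
proof -
  \<comment> \<open>A combination of the \<open>gact \<gamma>\<close> sends the vector of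
    \<open>pid X\<close> to the sum of \<open>N \<gamma>\<close> times \<open>E \<gamma>\<close>
    over all \<open>\<gamma>\<close> with range \<open>X\<close>, so the coefficients have to be
    read off there.\<close>
  define N where "N \<gamma> = coord (f (E (pid (ran \<gamma>)))) \<gamma>" for \<gamma>
  have "f = (\<lambda>t. \<Sum>\<gamma>\<in>rook n. sT (N \<gamma>) (gact \<gamma> t))"
  proof (rule linear_eqI[OF assms(1) lin_comb[OF linear_gact]])
    fix \<beta> assume \<beta>: "\<beta> \<in> T_index d n"
    let ?X = "dom \<beta>"
    obtain \<xi> where \<xi>: "\<xi> \<in> forms d n" "\<And>\<gamma>. \<gamma> \<in> T_index d n \<Longrightarrow>
        sact \<xi> (E \<gamma>) = (if \<gamma> \<in> rook n \<and> ran \<gamma> = ?X then E (\<beta> \<circ>\<^sub>m \<gamma>) else 0)"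
      using matrix_unit_form[OF \<beta>] by blast
    have p: "pid ?X \<in> rook n" by (rule pid_rook[OF T_index_dom[OF \<beta>]])
    have "sact \<xi> (E (pid ?X)) = E \<beta>"
      using p rook_T_index[OF p] by (simp add: \<xi>(2) ran_pid comp_pid)
    then have "f (E \<beta>) = sact \<xi> (f (E (pid ?X)))"
      using fun_cong[OF comm[OF \<xi>(1)], of "E (pid ?X)"] by simp
    also have "\<dots> = (\<Sum>\<gamma>\<in>T_index d n. sT (coord (f (E (pid ?X))) \<gamma>) (sact \<xi> (E \<gamma>)))"
      by (rule linear_expand[OF linear_sact])
    \<comment> \<open>The form kills every \<open>E \<gamma>\<close> whose index is not a rook
      element.\<close>
    also have "\<dots> = (\<Sum>\<gamma>\<in>rook n. sT (coord (f (E (pid ?X))) \<gamma>) (sact \<xi> (E \<gamma>)))"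
      using finite_T_index rook_T_index by (intro sum.mono_neutral_right) (auto simp: \<xi>(2))
    also have "\<dots> = (\<Sum>\<gamma>\<in>rook n. sT (N \<gamma>) (gact \<gamma> (E \<beta>)))"
      by (rule sum.cong) (auto simp: \<xi>(2) rook_T_index gact_E[OF \<beta>] N_def)
    finally show "f (E \<beta>) = (\<Sum>\<gamma>\<in>rook n. sT (N \<gamma>) (gact \<gamma> (E \<beta>)))" .
  qed
  then show ?thesis
    using ract_image_comb[of "rook n" gact N] gact_image by simp
qed

text \<open>For \<open>\<iota>\<close> the identity of \<open>ran \<tau>\<close>, the coefficient of \<open>e\<^bsub>\<tau>\<^esub>\<close> in \<open>e\<^bsub>\<iota>\<^esub> \<cdot> a\<close> is the sum of \<open>a \<sigma>\<close> over all
  extensions \<open>\<sigma>\<close> of \<open>\<tau>\<close>, which is triangular in the size of the range.\<close>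

lemma ract_eq_0:
  assumes "a \<in> carrier R" and zero: "\<And>t. ract a t = 0"
  shows "a \<tau> = 0"
proof (cases "\<tau> \<in> rook n")
  case True
  then show ?thesis
  proof (induction "n - card (ran \<tau>)" arbitrary: \<tau> rule: less_induct)
    case less
    let ?X = "ran \<tau>"
    have X: "?X \<subseteq> {1..n}" using rookD(2)[OF less.prems] .
    have p: "pid ?X \<in> T_index d n" by (rule rook_T_index[OF pid_rook[OF X]])
    \<comment> \<open>Only extensions of \<open>\<tau>\<close> have a nonzero coordinate here. A
      proper one has larger range, so its coefficient is 0 by the induction, which starts from the
      largest ranges.\<close>
    have "a \<sigma> * coord (ract1 \<sigma> (E (pid ?X))) \<tau> = (if \<sigma> = \<tau> then a \<tau> else 0)" if \<sigma>: "\<sigma> \<in> rook n" for \<sigma>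
    proof (cases "?X \<subseteq> ran \<sigma>")
      case sub: True
      have c: "coord (ract1 \<sigma> (E (pid ?X))) \<tau> = (if \<tau> = pid ?X \<circ>\<^sub>m \<sigma> then 1 else 0)"
        using sub coord_basis[OF rook_T_index[OF less.prems] T_index_comp[OF p \<sigma>]]
        by (simp add: ract1_E[OF p] dom_pid)
      show ?thesis
      proof (cases "?X = ran \<sigma>")
        case True
        then show ?thesis using c by (auto simp: pid_comp)
      next
        case False
        have ran\<sigma>: "ran \<sigma> \<subseteq> {1..n}" using rookD(2)[OF \<sigma>] .
        then have "finite (ran \<sigma>)" using finite_subset by blast
        then have "card ?X < card (ran \<sigma>)" using sub False by (intro psubset_card_mono) auto
        moreover have "card (ran \<sigma>) \<le> n" using card_mono[OF _ ran\<sigma>] by simp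
        ultimately have "a \<sigma> = 0" by (intro less.hyps \<sigma>) auto
        then show ?thesis using False by auto
      qed
    next
      case False
      then show ?thesis by (auto simp: ract1_E[OF p] dom_pid coord_0)
    qed
    then have "coord (ract a (E (pid ?X))) \<tau> = (\<Sum>\<sigma>\<in>rook n. if \<sigma> = \<tau> then a \<tau> else 0)"
      unfolding rook_act_def coord_sum coord_scale by (intro sum.cong) auto
    then show ?case using less.prems finite_rook by (simp add: zero coord_0)
  qed
qed (use assms(1) in \<open>simp add: carrier_R\<close>)

section \<open>Faithfulness of both actions and the isomorphisms\<close>

lemma inj_on_ract: "inj_on ract (carrier R)"
proof (rule inj_onI)
  fix a b assume *: "a \<in> carrier R" "b \<in> carrier R" "ract a = ract b"
  let ?c = "\<lambda>\<sigma>. a \<sigma> - b \<sigma>"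
  have "?c \<in> carrier R" using *(1,2) by (simp add: carrier_R)
  moreover have "ract ?c t = 0" for t
    using fun_cong[OF *(3), of t] by (simp add: rook_act_def scale_left_diff_distrib sum_subtractf)
  ultimately have "?c \<tau> = 0" for \<tau> by (rule ract_eq_0)
  then show "a = b" by auto
qed

lemma inj_on_sact: "inj_on sact (forms d n)"
proof (rule inj_onI)
  fix \<xi> \<eta> :: "('a mat \<Rightarrow> 'a) \<Rightarrow> 'a"
  assume *: "\<xi> \<in> forms d n" "\<eta> \<in> forms d n" "sact \<xi> = sact \<eta>"
  show "\<xi> = \<eta>"
  proof (rule forms_cc_eqI[OF *(1,2)])
    fix X \<alpha> \<beta> assume **: "X \<subseteq> {1..n}" "\<alpha> \<in> Gam X d" "\<beta> \<in> Gam X d"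
    then have "\<alpha> \<in> T_index d n" "\<beta> \<in> T_index d n" "dom \<alpha> = dom \<beta>"
      using Gam_T_index by (auto simp: Gam_def)
    then show "\<xi> (cc d \<alpha> \<beta>) = \<eta> (cc d \<alpha> \<beta>)"
      using coord_sact[of \<alpha> \<beta> \<xi>] coord_sact[of \<alpha> \<beta> \<eta>] *(3) by simp
  qed
qed

text \<open>Both matrices are block diagonal, so the intermediate index keeps the common domain and
  the matrix product is the defining formula of \<open>schur_mult\<close>.\<close>

lemma sact_mult: "sact (schur_mult d n \<xi> \<eta>) = sact \<xi> \<circ> sact \<eta>"
proof (rule sym, rule sact_eqI[OF lin_comp[OF linear_sact linear_sact]])
  fix \<alpha> \<beta> assume \<alpha>: "\<alpha> \<in> T_index d n" and \<beta>: "\<beta> \<in> T_index d n"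
  let ?G = "Gam (dom \<beta>) d"
  have I: "\<gamma> \<in> T_index d n" "dom \<gamma> = dom \<beta>" if "\<gamma> \<in> ?G" for \<gamma>
    using Gam_T_index[OF that T_index_dom[OF \<beta>]] that by (auto simp: Gam_def)
  have "coord ((sact \<xi> \<circ> sact \<eta>) (E \<beta>)) \<alpha> = (\<Sum>\<gamma>\<in>?G. \<eta> (cc d \<gamma> \<beta>) * coord (sact \<xi> (E \<gamma>)) \<alpha>)"
    by (simp add: sact_E[OF \<beta>] lin_sum[OF linear_sact] lin_scale[OF linear_sact] coord_sum coord_scale)
  also have "\<dots> = (\<Sum>\<gamma>\<in>?G. if dom \<alpha> = dom \<beta> then \<xi> (cc d \<alpha> \<gamma>) * \<eta> (cc d \<gamma> \<beta>) else 0)"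
    by (rule sum.cong) (auto simp: coord_sact[OF \<alpha>] I)
  also have "\<dots> = (if dom \<alpha> = dom \<beta> then schur_mult d n \<xi> \<eta> (cc d \<alpha> \<beta>) else 0)"
    using schur_mult(2)[where \<xi> = \<xi> and \<eta> = \<eta>, OF T_index_dom[OF \<beta>] _ T_index_Gam[OF \<beta>]]
      T_index_Gam[OF \<alpha>] by auto
  finally show "coord ((sact \<xi> \<circ> sact \<eta>) (E \<beta>)) \<alpha> =
    (if dom \<alpha> = dom \<beta> then schur_mult d n \<xi> \<eta> (cc d \<alpha> \<beta>) else 0)" .
qed

lemma sact_one: "sact (schur_one d n) = id"
proof (rule sym, rule sact_eqI)
  show "lin id" by (simp add: Vector_Spaces.linear_iff vector_space_axioms)
  fix \<alpha> \<beta> assume \<alpha>: "\<alpha> \<in> T_index d n" and \<beta>: "\<beta> \<in> T_index d n"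
  show "coord (id (E \<beta>)) \<alpha> = (if dom \<alpha> = dom \<beta> then schur_one d n (cc d \<alpha> \<beta>) else 0)"
    using T_index_Gam[OF \<alpha>]
    by (auto simp: coord_basis[OF \<alpha> \<beta>] schur_one(2)[OF T_index_dom[OF \<beta>] _ T_index_Gam[OF \<beta>]])
qed

lemma sact_add: "sact (\<lambda>f. \<xi> f + \<eta> f) = (\<lambda>t. sact \<xi> t + sact \<eta> t)"
  by (rule sym, rule sact_eqI)
    (auto simp: Vector_Spaces.linear_iff vector_space_axioms lin_add[OF linear_sact]
      lin_scale[OF linear_sact] scale_right_distrib coord_add coord_sact)

lemma sact_smult: "sact (\<lambda>f. k * \<xi> f) = (\<lambda>t. sT k (sact \<xi> t))"
  by (rule sym, rule sact_eqI)
    (auto simp: Vector_Spaces.linear_iff vector_space_axioms lin_add[OF linear_sact]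
      lin_scale[OF linear_sact] scale_right_distrib coord_scale coord_sact mult.commute)

lemma carrier_op: "carrier (op_alg R) = carrier R"
  by (simp add: op_alg_def)

lemma image_sact: "sact ` carrier S = carrier (centralizer_alg sT (ract ` carrier (op_alg R)))"
proof
  show "sact ` carrier S \<subseteq> carrier (centralizer_alg sT (ract ` carrier (op_alg R)))"
    using linear_sact sact_ract by (auto simp: centralizer_alg_def)
  show "carrier (centralizer_alg sT (ract ` carrier (op_alg R))) \<subseteq> sact ` carrier S"
  proof
    fix f assume "f \<in> carrier (centralizer_alg sT (ract ` carrier (op_alg R)))"
    then have f: "lin f" "\<And>k. k \<in> ract ` carrier R \<Longrightarrow> f \<circ> k = k \<circ> f"
      by (auto simp: centralizer_alg_def carrier_op)
    then have "\<exists>\<xi>\<in>forms d n. f = sact \<xi>"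
      using ract1_image by (intro centralizer_ract_sact) auto
    then show "f \<in> sact ` carrier S" by (auto simp: schur_alg_def)
  qed
qed

lemma image_ract: "ract ` carrier (op_alg R) = carrier (centralizer_alg sT (sact ` carrier S))"
proof
  show "ract ` carrier (op_alg R) \<subseteq> carrier (centralizer_alg sT (sact ` carrier S))"
    using linear_ract sact_ract[symmetric] by (auto simp: centralizer_alg_def)
  show "carrier (centralizer_alg sT (sact ` carrier S)) \<subseteq> ract ` carrier (op_alg R)"
    using centralizer_sact_ract by (auto simp: centralizer_alg_def carrier_op schur_alg_def)
qed

lemma sact_iso: "sact \<in> alg_iso S (centralizer_alg sT (ract ` carrier (op_alg R)))"
proof -
  have "bij_betw sact (carrier S) (carrier (centralizer_alg sT (ract ` carrier (op_alg R))))"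
    unfolding image_sact[symmetric] using inj_on_sact
    by (intro inj_on_imp_bij_betw) (simp add: schur_alg_def)
  then show ?thesis
    using image_sact
    by (auto simp: alg_iso_def ring_iso_def ring_hom_def schur_alg_def centralizer_alg_def
        sact_mult sact_one sact_add sact_smult)
qed

text \<open>The opposite multiplication undoes the reversal in \<open>ract_mult\<close>, which makes
  \<open>ract\<close> multiplicative with respect to composition.\<close>

lemma ract_iso: "ract \<in> alg_iso (op_alg R) (centralizer_alg sT (sact ` carrier S))"
proof -
  have "bij_betw ract (carrier (op_alg R)) (carrier (centralizer_alg sT (sact ` carrier S)))"
    unfolding image_ract[symmetric] using inj_on_ract
    by (intro inj_on_imp_bij_betw) (simp add: carrier_op)
  moreover have "ract a \<in> carrier (centralizer_alg sT (sact ` carrier S))" if "a \<in> carrier (op_alg R)" for a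
    using that image_ract by blast
  moreover have "ract (a \<otimes>\<^bsub>op_alg R\<^esub> b) = ract a \<circ> ract b" for a b
    by (auto simp: op_alg_def ract_mult)
  moreover have "ract (a \<oplus>\<^bsub>op_alg R\<^esub> b) = (\<lambda>t. ract a t + ract b t)" for a b
    by (auto simp: op_alg_def ract_add)
  moreover have "ract (k \<odot>\<^bsub>op_alg R\<^esub> a) = (\<lambda>t. sT k (ract a t))" for k a
    by (auto simp: op_alg_def ract_smult)
  moreover have "ract \<one>\<^bsub>op_alg R\<^esub> = id"
    by (auto simp: op_alg_def ract_one)
  ultimately show ?thesis
    unfolding alg_iso_def ring_iso_def ring_hom_def by (simp add: centralizer_alg_def)
qed

end

theorem theorem10:
  fixes n d :: nat
    and sU :: "'a::field_char_0 \<Rightarrow> 'u::ab_group_add \<Rightarrow> 'u"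
    and e :: "nat option \<Rightarrow> 'u"
    and sT :: "'a \<Rightarrow> 't::ab_group_add \<Rightarrow> 't"
    and tens :: "(nat \<Rightarrow> 'u) \<Rightarrow> 't"
  assumes "1 \<le> n" and "n \<le> d"
    and "basis_family sU (U_index d) e"
    and "is_tensor_power sU sT n tens"
  shows
    "let E = e_tens tens e;
         S = (schur_alg d n :: ('a, ('a mat \<Rightarrow> 'a) \<Rightarrow> 'a) module);
         R = (rook_alg n :: ('a, (nat \<rightharpoonup> nat) \<Rightarrow> 'a) module);
         imgS = schur_act sT d n E ` carrier S;
         imgR = rook_act sT d n E ` carrier (op_alg R)
     in right_module_over R sT (rook_act sT d n E) \<and>
        imgS = carrier (centralizer_alg sT imgR) \<and>
        imgR = carrier (centralizer_alg sT imgS) \<and>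
        alg_iso S (centralizer_alg sT imgR) \<noteq> {} \<and>
        alg_iso (op_alg R) (centralizer_alg sT imgS) \<noteq> {}"
proof -
  interpret finite_basis sT "T_index d n" "e_tens tens e"
    by (rule tensor_power_basis[OF assms(3,4)])
  interpret tensor_actions sT d n "e_tens tens e"
    by unfold_locales (rule assms(2))
  show ?thesis
    unfolding Let_def
    using right_module_ract image_sact image_ract sact_iso ract_iso by blast
qed

end
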